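(* Let $r\ge1$, let $A\in\mathbb{C}_r^{m\times n}$ and $\widetilde A=A+E\in\mathbb{C}_r^{m\times n}$ have generalized polar decompositions $A=QH$ and $\widetilde A=\widetilde Q\widetilde H$, and let $\sigma_1\ge\dots\ge\sigma_r>0$ and $\widetilde\sigma_1\ge\dots\ge\widetilde\sigma_r>0$ be the nonzero singular values of $A$ and $\widetilde A$. Then $$\|Q-\widetilde Q\|_F\le \sqrt{\max_{1\le k\le r}\frac{4k}{\sum_{j=1}^{r-k}(\sigma_j-\widetilde\sigma_j)^2+\sum_{j=1}^{k}(\sigma_{r+1-j}+\widetilde\sigma_{r-k+j})^2}}\;\|E\|_F .$$ Moreover the coefficient of $\|E\|_F$ is optimal: for given $m,n$ and given $\sigma_1\ge\dots\ge\sigma_r>0$, $\widetilde\sigma_1\ge\dots\ge\widetilde\sigma_r>0$ with $r\le\min(m,n)$, it cannot be replaced by any smaller number so that the inequality still holds for all $A,\widetilde A\in\mathbb{C}_r^{m\times n}$ with these nonzero singular values.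
   Context: $\mathbb{C}^{m\times n}_r$ denotes the set of complex $m\times n$ matrices of rank $r$; $\|\cdot\|_F$ is the Frobenius norm. For $A\in\mathbb{C}_r^{m\times n}$, the generalized polar decomposition is $A=QH$ with $Q\in\mathbb{C}_r^{m\times n}$ subunitary (a partial isometry) and $H\in\mathbb{C}_r^{n\times n}$ positive semidefinite, subject to $\mathcal R(Q^* )=\mathcal R(H)$ (column spaces), which makes it unique; in fact $H=|A|:=(A^*A)^{1/2}$. $Q$ is the subunitary polar factor and $H$ the positive polar factor. Empty sums are $0$. *)

theory Defs
  imports
    "Jordan_Normal_Form.Schur_Decomposition"
    "Jordan_Normal_Form.Char_Poly"
    "Jordan_Normal_Form.DL_Rank"
begin

definition rank_mat :: "nat \<Rightarrow> nat \<Rightarrow> nat \<Rightarrow> complex mat set" where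
  "rank_mat m n r = {A \<in> carrier_mat m n. vec_space.rank m A = r}"

definition frobenius_norm :: "complex mat \<Rightarrow> real" where
  "frobenius_norm A = sqrt (\<Sum>i<dim_row A. \<Sum>j<dim_col A. (cmod (A $$ (i, j)))\<^sup>2)"

definition column_space :: "complex mat \<Rightarrow> complex vec set" where
  "column_space A = vec_space.col_space (dim_row A) A"

definition positive_semidefinite :: "complex mat \<Rightarrow> bool" where
  "positive_semidefinite H \<longleftrightarrow>
     square_mat H \<and> mat_adjoint H = H \<and>
     (\<forall>x \<in> carrier_vec (dim_col H). 0 \<le> (H *\<^sub>v x) \<bullet>c x)"

(* Partial isometry: Q preserves the (squared) Euclidean norm on the column space of its
   adjoint, i.e. on the orthogonal complement of its kernel. *)
definition subunitary :: "complex mat \<Rightarrow> bool" where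
  "subunitary Q \<longleftrightarrow>
     (\<forall>x \<in> column_space (mat_adjoint Q). (Q *\<^sub>v x) \<bullet>c (Q *\<^sub>v x) = x \<bullet>c x)"

definition generalized_polar_decomposition ::
    "nat \<Rightarrow> nat \<Rightarrow> nat \<Rightarrow> complex mat \<Rightarrow> complex mat \<Rightarrow> complex mat \<Rightarrow> bool" where
  "generalized_polar_decomposition m n r A Q H \<longleftrightarrow>
     A = Q * H \<and>
     Q \<in> rank_mat m n r \<and> subunitary Q \<and>
     H \<in> rank_mat n n r \<and> positive_semidefinite H \<and>
     column_space (mat_adjoint Q) = column_space H"

(* All n singular values of an m x n matrix, with multiplicity and including zeros.  The
   eigenvalues of (mat_adjoint A * A) are real and nonnegative, so Re loses nothing. *)
definition singular_values :: "complex mat \<Rightarrow> real multiset" where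
  "singular_values A = image_mset (\<lambda>z. sqrt (Re z)) (proots (char_poly (mat_adjoint A * A)))"

definition has_nonzero_singular_values :: "complex mat \<Rightarrow> nat \<Rightarrow> (nat \<Rightarrow> real) \<Rightarrow> bool" where
  "has_nonzero_singular_values A r \<sigma> \<longleftrightarrow>
     {# s \<in># singular_values A. s \<noteq> 0 #} = image_mset \<sigma> (mset_set {1..r})"

(* sigma 1 >= ... >= sigma r > 0; values of the sequences outside {1..r} are irrelevant. *)
definition decreasing_positive :: "nat \<Rightarrow> (nat \<Rightarrow> real) \<Rightarrow> bool" where
  "decreasing_positive r \<sigma> \<longleftrightarrow> antimono_on {1..r} \<sigma> \<and> (\<forall>j \<in> {1..r}. 0 < \<sigma> j)"

definition polar_coefficient :: "nat \<Rightarrow> (nat \<Rightarrow> real) \<Rightarrow> (nat \<Rightarrow> real) \<Rightarrow> real" where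
  "polar_coefficient r \<sigma> \<sigma>' =
     sqrt (MAX k \<in> {1..r}.
       4 * real k /
         ((\<Sum>j = 1..r - k. (\<sigma> j - \<sigma>' j)\<^sup>2) +
          (\<Sum>j = 1..k. (\<sigma> (r + 1 - j) + \<sigma>' (r - k + j))\<^sup>2)))"

end

theory Submission
  imports Defs
begin

text \<open>
  Write \<open>A = \<Sum>\<^sub>i \<sigma>\<^sub>i u\<^sub>i v\<^sub>i\<^sup>*\<close> and \<open>A' = A + E = \<Sum>\<^sub>j \<sigma>'\<^sub>j w\<^sub>j x\<^sub>j\<^sup>*\<close> with orthonormal families of
  length \<open>r\<close>.  The subunitary polar factors are the same sums with all weights replaced by \<open>1\<close>:
  the positive factor is the positive semidefinite square root of \<open>A\<^sup>* A\<close>, so it has the vectors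
  \<open>v\<^sub>i\<close> as eigenvectors (\<open>polar_singular_expansion\<close>).  With the real array
  \<open>W\<^sub>i\<^sub>j = Re (\<langle>u\<^sub>i, w\<^sub>j\<rangle> \<langle>v\<^sub>i, x\<^sub>j\<rangle>\<^sup>*)\<close> both Frobenius norms become affine in \<open>W\<close>
  (\<open>singular_expansion_distance\<close>): the square of the norm of \<open>Q - Q'\<close> is \<open>2 r - 2 \<Sum> W\<^sub>i\<^sub>j\<close>, and that of
  \<open>E\<close> is \<open>\<Sum> \<sigma>\<^sub>i\<^sup>2 + \<Sum> \<sigma>'\<^sub>j\<^sup>2 - 2 \<Sum> W\<^sub>i\<^sub>j \<sigma>\<^sub>i \<sigma>'\<^sub>j\<close>.  By Bessel's inequality the absolute
  values in each row and in each column of \<open>W\<close> sum to at most \<open>1\<close>.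

  It remains to bound \<open>\<Sum> W\<^sub>i\<^sub>j \<sigma>\<^sub>i \<sigma>'\<^sub>j\<close> for such an array when \<open>\<Sum> W\<^sub>i\<^sub>j = r - 2 q\<close> is given.
  Summation by parts in both indices turns this sum into a combination, with nonnegative coefficients,
  of the sums of \<open>W\<close> over top-left corners \<open>{1..a} \<times> {1..b}\<close>.  Each corner sum obeys an
  elementary bound (\<open>corner_sum_le\<close>).  For an integer \<open>q = k\<close> all these bounds are attained at once by
  one signed permutation array: it pairs the \<open>r - k\<close> largest values in order with sign \<open>1\<close>, and the
  \<open>k\<close> smallest values in opposite order with sign \<open>-1\<close> (\<open>corner_sum_signed_flip\<close>).  As functions of
  \<open>q\<close> the bounds are affine between consecutive integers (\<open>corner_bound_affine\<close>), so nothing is lost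
  by interpolating.  Hence only the signed permutations matter, and for them the ratio of the two
  squared norms is \<open>4 k\<close> over the \<open>k\<close>-th denominator of the coefficient (\<open>bilinear_minimum\<close>,
  \<open>flip_distance_eq\<close>).

  The coefficient is optimal because each of these signed permutations with \<open>k \<ge> 1\<close> is realised by a pair of
  rectangular diagonal matrices (\<open>polar_perturbation_bound_sharp\<close>).
\<close>

section \<open>Bilinear sums over signed doubly substochastic arrays\<close>

text \<open>
  The extremal pairing of indices: the first \<open>r - k\<close> are kept, and the last \<open>k\<close> are reversed.
  Pairs in the reversed part carry the sign \<open>-1\<close>.
\<close>

definition flip_tail :: "nat \<Rightarrow> nat \<Rightarrow> nat \<Rightarrow> nat" where
  "flip_tail r k i = (if i \<le> r - k then i else 2 * r - k + 1 - i)"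

definition tail_sign :: "nat \<Rightarrow> nat \<Rightarrow> nat \<Rightarrow> real" where
  "tail_sign r k i = (if i \<le> r - k then 1 else - 1)"

definition signed_flip :: "nat \<Rightarrow> nat \<Rightarrow> nat \<Rightarrow> nat \<Rightarrow> real" where
  "signed_flip r k i j = (if j = flip_tail r k i then tail_sign r k i else 0)"

lemma bij_flip_tail: "k \<le> r \<Longrightarrow> bij_betw (flip_tail r k) {1..r} {1..r}"
  by (rule bij_betwI[where g = "flip_tail r k"]) (auto simp: flip_tail_def)

text \<open>
  For an integer \<open>q = k\<close> this is the sum of the extremal array over the corner
  \<open>{1..a} \<times> {1..b}\<close>: the minimum counts the positive entries there, and the maximum counts the
  negative ones.  The arguments are real because \<open>q\<close> has to range over an interval.
\<close>

definition corner_bound :: "real \<Rightarrow> real \<Rightarrow> real \<Rightarrow> real \<Rightarrow> real" where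
  "corner_bound r q a b = min (min a b) (r - q) - max 0 (a + b + q - 2 * r)"

lemma corner_sum_signed_flip:
  assumes "k \<le> r" "a \<le> r" "b \<le> r"
  shows "(\<Sum>i = 1..a. \<Sum>j = 1..b. signed_flip r k i j) = corner_bound r k a b"
proof -
  have inner: "(\<Sum>j = 1..b. signed_flip r k i j)
      = (if i \<in> {1..min (min a b) (r - k)} then 1 else 0)
        - (if i \<in> {max (r - k + 1) (2 * r - k + 1 - b)..a} then 1 else 0)"
    if i: "i \<in> {1..a}" for i
  proof -
    have "(\<Sum>j = 1..b. signed_flip r k i j)
        = (if flip_tail r k i \<in> {1..b} then tail_sign r k i else 0)"
      unfolding signed_flip_def by (subst sum.delta) auto
    also have "\<dots> = (if i \<in> {1..min (min a b) (r - k)} then 1 else 0)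
        - (if i \<in> {max (r - k + 1) (2 * r - k + 1 - b)..a} then 1 else 0)"
      using i assms by (auto simp: flip_tail_def tail_sign_def)
    finally show ?thesis .
  qed
  have "(\<Sum>i = 1..a. \<Sum>j = 1..b. signed_flip r k i j)
      = (\<Sum>i = 1..a. if i \<in> {1..min (min a b) (r - k)} then 1 else 0)
        - (\<Sum>i = 1..a. if i \<in> {max (r - k + 1) (2 * r - k + 1 - b)..a} then 1 else 0)"
    by (subst sum_subtractf[symmetric], rule sum.cong[OF refl], rule inner)
  also have "(\<Sum>i = 1..a. if i \<in> {1..min (min a b) (r - k)} then 1 else 0)
      = (\<Sum>i \<in> {1..min (min a b) (r - k)}. (1::real))"
    by (rule sum.mono_neutral_cong_right) auto
  also have "\<dots> = real (min (min a b) (r - k))" by simp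
  also have "(\<Sum>i = 1..a. if i \<in> {max (r - k + 1) (2 * r - k + 1 - b)..a} then 1 else 0)
      = (\<Sum>i \<in> {max (r - k + 1) (2 * r - k + 1 - b)..a}. (1::real))"
    by (rule sum.mono_neutral_cong_right) auto
  also have "\<dots> = real (a + 1 - (2 * r - k + 1 - b))" using assms by simp
  finally show ?thesis
    using assms by (simp add: corner_bound_def of_nat_min of_nat_diff)
qed

text \<open>
  In \<open>q\<close> the minimum has its only kink at \<open>q = r - min a b\<close> and the maximum at \<open>q = 2 r - a - b\<close>.
  Both are integers, so there is no kink strictly between \<open>k\<close> and \<open>k + 1\<close>.
\<close>

lemma corner_bound_affine:
  fixes a b r k :: nat and \<theta> :: real
  assumes "0 \<le> \<theta>" "\<theta> \<le> 1"
  shows "corner_bound r (k + \<theta>) a b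
    = (1 - \<theta>) * corner_bound r k a b + \<theta> * corner_bound r (k + 1) a b"
proof -
  have min_affine: "min (real c) (real r - (k + \<theta>))
      = (1 - \<theta>) * min (real c) (real r - k) + \<theta> * min (real c) (real r - (real k + 1))" for c :: nat
  proof (cases "r \<le> c + k")
    case True
    hence "real r \<le> c + k" by (metis of_nat_add of_nat_le_iff)
    hence "min (real c) (real r - (k + \<theta>)) = real r - (k + \<theta>)" "min (real c) (real r - k) = real r - k"
      "min (real c) (real r - (real k + 1)) = real r - (real k + 1)" using assms by auto
    thus ?thesis by (simp only:) (simp add: algebra_simps)
  next
    case False
    hence "real r \<ge> c + k + 1" by linarith
    hence "min (real c) (real r - (k + \<theta>)) = c" "min (real c) (real r - k) = c"
      "min (real c) (real r - (real k + 1)) = c" using assms by auto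
    thus ?thesis by (simp only:) (simp add: algebra_simps)
  qed
  have max_affine: "max 0 (a + b + (k + \<theta>) - 2 * real r)
      = (1 - \<theta>) * max 0 (real a + b + k - 2 * r) + \<theta> * max 0 (a + b + (real k + 1) - 2 * r)"
  proof (cases "2 * r \<le> a + b + k")
    case True
    hence "2 * real r \<le> real a + b + k" by linarith
    hence "max 0 (a + b + (k + \<theta>) - 2 * real r) = a + b + (k + \<theta>) - 2 * real r"
      "max 0 (real a + b + k - 2 * r) = real a + b + k - 2 * r"
      "max 0 (a + b + (real k + 1) - 2 * r) = a + b + (real k + 1) - 2 * r"
      using assms by auto
    thus ?thesis by (simp only:) (simp add: algebra_simps)
  next
    case False
    hence "2 * real r \<ge> real a + b + k + 1" by linarith
    hence "max 0 (a + b + (k + \<theta>) - 2 * real r) = 0"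
      "max 0 (real a + b + k - 2 * r) = 0"
      "max 0 (a + b + (real k + 1) - 2 * r) = 0"
      using assms by auto
    thus ?thesis by (simp only:)
  qed
  show ?thesis
    using min_affine[of "min a b"] max_affine
    by (simp add: corner_bound_def of_nat_min algebra_simps)
qed

lemma sum_Icc_split: "a \<le> r \<Longrightarrow> sum f {1..r} = sum f {1..a} + sum f {a<..r::nat}"
  for f :: "nat \<Rightarrow> real"
proof -
  assume "a \<le> r"
  hence "{1..r} = {1..a} \<union> {a<..r}" by auto
  thus ?thesis by (simp only:) (rule sum.union_disjoint, auto)
qed

text \<open>
  Split \<open>W\<close> into its positive and negative parts.  A corner is bounded by the total of its own rows
  or columns, or by the total of the whole array after removing the rows and columns outside the
  corner; each of these sets of rows or columns has total absolute value at most its size.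
\<close>

lemma corner_sum_le:
  fixes W :: "nat \<Rightarrow> nat \<Rightarrow> real" and q :: real
  assumes row: "\<And>i. i \<in> {1..r} \<Longrightarrow> (\<Sum>j = 1..r. \<bar>W i j\<bar>) \<le> 1"
    and col: "\<And>j. j \<in> {1..r} \<Longrightarrow> (\<Sum>i = 1..r. \<bar>W i j\<bar>) \<le> 1"
    and q: "(\<Sum>i = 1..r. \<Sum>j = 1..r. W i j) = r - 2 * q"
    and a: "a \<le> r" and b: "b \<le> r"
  shows "(\<Sum>i = 1..a. \<Sum>j = 1..b. W i j) \<le> corner_bound r q a b"
proof -
  define p n where "p i j = (\<bar>W i j\<bar> + W i j) / 2" and "n i j = (\<bar>W i j\<bar> - W i j) / 2" for i j
  have pn: "0 \<le> p i j" "0 \<le> n i j" "W i j = p i j - n i j" "\<bar>W i j\<bar> = p i j + n i j" for i j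
    by (auto simp: p_def n_def field_simps)
  define S where "S f A B = (\<Sum>i\<in>A. \<Sum>j\<in>B. f i j)" for f :: "nat \<Rightarrow> nat \<Rightarrow> real" and A B
  have S0: "0 \<le> S p A B" "0 \<le> S n A B" for A B by (auto simp: S_def intro!: sum_nonneg pn)
  have SW: "S W A B = S p A B - S n A B" for A B by (simp add: S_def pn(3) sum_subtractf)
  have SA: "S (\<lambda>i j. \<bar>W i j\<bar>) A B = S p A B + S n A B" for A B
    by (simp add: S_def pn(4) sum.distrib)
  have rowS: "S p A {1..r} + S n A {1..r} \<le> card A" if "A \<subseteq> {1..r}" for A
  proof -
    have "S (\<lambda>i j. \<bar>W i j\<bar>) A {1..r} \<le> (\<Sum>i\<in>A. 1)"
      unfolding S_def by (rule sum_mono) (use that row in auto)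
    thus ?thesis by (simp add: SA)
  qed
  have colS: "S p {1..r} B + S n {1..r} B \<le> card B" if "B \<subseteq> {1..r}" for B
  proof -
    have "S (\<lambda>i j. \<bar>W i j\<bar>) {1..r} B = (\<Sum>j\<in>B. \<Sum>i = 1..r. \<bar>W i j\<bar>)"
      unfolding S_def by (rule sum.swap)
    also have "\<dots> \<le> (\<Sum>j\<in>B. 1)"
      by (rule sum_mono) (use that col in auto)
    finally show ?thesis by (simp add: SA)
  qed
  have split_row: "S f {1..r} B = S f {1..a} B + S f {a<..r} B" for f B
    unfolding S_def by (rule sum_Icc_split[OF a])
  have split_col: "S f A {1..r} = S f A {1..b} + S f A {b<..r}" for f A
    unfolding S_def sum.distrib[symmetric] by (intro sum.cong refl sum_Icc_split[OF b])
  have tot: "S p {1..r} {1..r} - S n {1..r} {1..r} = r - 2 * q"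
    using q by (simp add: SW[symmetric] S_def[symmetric])
  have r1: "S p {1..a} {1..r} + S n {1..a} {1..r} \<le> a"
    and r2: "S p {a<..r} {1..r} + S n {a<..r} {1..r} \<le> real r - a"
    using rowS[of "{1..a}"] rowS[of "{a<..r}"] a by (auto simp: of_nat_diff subset_iff)
  have c1: "S p {1..r} {1..b} + S n {1..r} {1..b} \<le> b"
    and c2: "S p {1..r} {b<..r} + S n {1..r} {b<..r} \<le> real r - b"
    using colS[of "{1..b}"] colS[of "{b<..r}"] b by (auto simp: of_nat_diff subset_iff)
  note r1 = r1[unfolded split_col] and r2 = r2[unfolded split_col]
    and c1 = c1[unfolded split_row] and c2 = c2[unfolded split_row]
    and tot = tot[unfolded split_row split_col]
  note nn = S0[of "{1..a}" "{1..b}"] S0[of "{1..a}" "{b<..r}"] S0[of "{a<..r}" "{1..b}"]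
    S0[of "{a<..r}" "{b<..r}"]
  \<comment> \<open>The bound is a minimum of three terms minus a maximum of two, hence six linear inequalities.\<close>
  let ?V = "S p {1..a} {1..b} - S n {1..a} {1..b}"
  have "?V \<le> a" "?V \<le> b" using r1 c1 nn by linarith+
  moreover have "?V \<le> r - q" using r1 r2 nn tot by linarith
  moreover have "?V \<le> a - (a + b + q - 2 * r)" using r1 r2 c2 nn tot by linarith
  moreover have "?V \<le> b - (a + b + q - 2 * r)" using r2 c1 c2 nn tot by linarith
  moreover have "?V \<le> r - q - (a + b + q - 2 * r)" using r2 c2 nn tot by linarith
  ultimately have "?V \<le> corner_bound r q a b"
    by (simp add: corner_bound_def min_def max_def)
  thus ?thesis by (simp add: SW[symmetric] S_def[symmetric])
qed

lemma sum_by_parts: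
  fixes w x :: "nat \<Rightarrow> real"
  shows "(\<Sum>i = 1..r. w i * x i)
    = (\<Sum>a = 1..r. (x a - x (Suc a)) * (\<Sum>i = 1..a. w i)) + x (Suc r) * (\<Sum>i = 1..r. w i)"
  by (induction r) (auto simp: algebra_simps)

lemma double_sum_by_parts:
  fixes W :: "nat \<Rightarrow> nat \<Rightarrow> real"
  assumes "x (Suc r) = 0" "y (Suc r) = 0"
  shows "(\<Sum>i = 1..r. \<Sum>j = 1..r. W i j * x i * y j)
    = (\<Sum>a = 1..r. \<Sum>b = 1..r. (x a - x (Suc a)) * (y b - y (Suc b)) *
        (\<Sum>i = 1..a. \<Sum>j = 1..b. W i j))"
proof -
  have "(\<Sum>i = 1..r. \<Sum>j = 1..r. W i j * x i * y j)
      = (\<Sum>i = 1..r. (\<Sum>j = 1..r. W i j * y j) * x i)"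
    by (simp add: sum_distrib_left mult.commute mult.left_commute)
  also have "\<dots> = (\<Sum>a = 1..r. (x a - x (Suc a)) * (\<Sum>i = 1..a. \<Sum>j = 1..r. W i j * y j))"
    by (subst sum_by_parts) (simp add: assms)
  also have "\<dots> = (\<Sum>a = 1..r. (x a - x (Suc a)) * (\<Sum>j = 1..r. (\<Sum>i = 1..a. W i j) * y j))"
    by (subst sum.swap) (simp add: sum_distrib_right)
  also have "\<dots> = (\<Sum>a = 1..r. (x a - x (Suc a)) *
      (\<Sum>b = 1..r. (y b - y (Suc b)) * (\<Sum>j = 1..b. \<Sum>i = 1..a. W i j)))"
    by (subst sum_by_parts[of _ y]) (simp add: assms)
  also have "\<dots> = (\<Sum>a = 1..r. \<Sum>b = 1..r. (x a - x (Suc a)) * (y b - y (Suc b)) *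
        (\<Sum>j = 1..b. \<Sum>i = 1..a. W i j))"
    by (simp add: sum_distrib_left mult.assoc)
  also have "\<dots> = (\<Sum>a = 1..r. \<Sum>b = 1..r. (x a - x (Suc a)) * (y b - y (Suc b)) *
        (\<Sum>i = 1..a. \<Sum>j = 1..b. W i j))"
    by (intro sum.cong refl arg_cong[where f = "(*) _"] sum.swap)
  finally show ?thesis .
qed

lemma decreasing_positiveD:
  assumes "decreasing_positive r \<sigma>"
  shows "1 \<le> i \<Longrightarrow> i \<le> j \<Longrightarrow> j \<le> r \<Longrightarrow> \<sigma> j \<le> \<sigma> i" "1 \<le> i \<Longrightarrow> i \<le> r \<Longrightarrow> 0 < \<sigma> i"
  using assms unfolding decreasing_positive_def
  by (auto intro: monotone_onD[of "{1..r}" "(\<le>)" "(\<ge>)" \<sigma> i j])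

text \<open>
  After summation by parts in both indices the claim reduces to the corner bounds, because the
  differences of consecutive values of \<open>\<sigma>\<close> and \<open>\<sigma>'\<close> are nonnegative.  The hypothesis on
  \<open>k\<close> and \<open>\<theta>\<close> keeps \<open>k + 1\<close> within range unless its weight vanishes.
\<close>

lemma bilinear_sum_le_signed_flips:
  fixes W :: "nat \<Rightarrow> nat \<Rightarrow> real"
  assumes row: "\<And>i. i \<in> {1..r} \<Longrightarrow> (\<Sum>j = 1..r. \<bar>W i j\<bar>) \<le> 1"
    and col: "\<And>j. j \<in> {1..r} \<Longrightarrow> (\<Sum>i = 1..r. \<bar>W i j\<bar>) \<le> 1"
    and W: "(\<Sum>i = 1..r. \<Sum>j = 1..r. W i j) = r - 2 * (k + \<theta>)"
    and \<theta>: "0 \<le> \<theta>" "\<theta> \<le> 1" and k: "k + 1 \<le> r \<or> k \<le> r \<and> \<theta> = 0"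
    and dec: "decreasing_positive r \<sigma>" "decreasing_positive r \<sigma>'"
  shows "(\<Sum>i = 1..r. \<Sum>j = 1..r. W i j * \<sigma> i * \<sigma>' j)
    \<le> (1 - \<theta>) * (\<Sum>i = 1..r. \<Sum>j = 1..r. signed_flip r k i j * \<sigma> i * \<sigma>' j)
      + \<theta> * (\<Sum>i = 1..r. \<Sum>j = 1..r. signed_flip r (k + 1) i j * \<sigma> i * \<sigma>' j)"
proof -
  \<comment> \<open>Extending by zero beyond \<open>r\<close> removes the boundary terms and makes the last difference positive.\<close>
  define x y where "x i = (if i \<le> r then \<sigma> i else 0)" and "y i = (if i \<le> r then \<sigma>' i else 0)" for i
  have z: "x (Suc r) = 0" "y (Suc r) = 0" by (auto simp: x_def y_def)
  have x: "0 \<le> x a - x (Suc a)" and y: "0 \<le> y a - y (Suc a)" if "a \<in> {1..r}" for a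
    using that decreasing_positiveD(1)[OF dec(1), of a "Suc a"] decreasing_positiveD(2)[OF dec(1), of a]
      decreasing_positiveD(1)[OF dec(2), of a "Suc a"] decreasing_positiveD(2)[OF dec(2), of a]
    by (auto simp: x_def y_def)
  define c where "c a b = (x a - x (Suc a)) * (y b - y (Suc b))" for a b
  have parts: "(\<Sum>i = 1..r. \<Sum>j = 1..r. M i j * \<sigma> i * \<sigma>' j)
      = (\<Sum>a = 1..r. \<Sum>b = 1..r. c a b * (\<Sum>i = 1..a. \<Sum>j = 1..b. M i j))" for M
    using double_sum_by_parts[of x r y M, OF z] by (simp add: x_def y_def c_def)
  have flip: "\<theta>' * (\<Sum>i = 1..r. \<Sum>j = 1..r. signed_flip r l i j * \<sigma> i * \<sigma>' j)
      = (\<Sum>a = 1..r. \<Sum>b = 1..r. c a b * (\<theta>' * corner_bound r l a b))"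
    if "l \<le> r \<or> \<theta>' = 0" for l \<theta>'
  proof (cases "\<theta>' = 0")
    case False
    with that have "l \<le> r" by simp
    have "(\<Sum>i = 1..r. \<Sum>j = 1..r. signed_flip r l i j * \<sigma> i * \<sigma>' j)
        = (\<Sum>a = 1..r. \<Sum>b = 1..r. c a b * corner_bound r l a b)"
      unfolding parts
      by (intro sum.cong refl arg_cong[where f = "(*) _"] corner_sum_signed_flip \<open>l \<le> r\<close>) auto
    thus ?thesis by (simp add: sum_distrib_left mult.left_commute)
  qed simp
  have "(\<Sum>i = 1..r. \<Sum>j = 1..r. W i j * \<sigma> i * \<sigma>' j)
      \<le> (\<Sum>a = 1..r. \<Sum>b = 1..r. c a b * corner_bound r (k + \<theta>) a b)"
    unfolding parts
    by (intro sum_mono mult_left_mono corner_sum_le[OF row col W]) (auto simp: c_def intro!: mult_nonneg_nonneg x y)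
  also have "\<dots> = (\<Sum>a = 1..r. \<Sum>b = 1..r. c a b * ((1 - \<theta>) * corner_bound r k a b))
      + (\<Sum>a = 1..r. \<Sum>b = 1..r. c a b * (\<theta> * corner_bound r (k + 1) a b))"
    by (simp only: corner_bound_affine[OF \<theta>] sum.distrib distrib_left)
  also have "(\<Sum>a = 1..r. \<Sum>b = 1..r. c a b * ((1 - \<theta>) * corner_bound r k a b))
      = (1 - \<theta>) * (\<Sum>i = 1..r. \<Sum>j = 1..r. signed_flip r k i j * \<sigma> i * \<sigma>' j)"
    using k by (subst flip) auto
  also have "(\<Sum>a = 1..r. \<Sum>b = 1..r. c a b * (\<theta> * corner_bound r (k + 1) a b))
      = \<theta> * (\<Sum>i = 1..r. \<Sum>j = 1..r. signed_flip r (k + 1) i j * \<sigma> i * \<sigma>' j)"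
    using k by (subst flip) auto
  finally show ?thesis .
qed

text \<open>
  The squared Frobenius distance of two matrices whose singular vectors are matched by the extremal
  pairing; by \<open>flip_distance_eq\<close> it is the \<open>k\<close>-th denominator of the coefficient.
\<close>

definition flip_distance :: "nat \<Rightarrow> (nat \<Rightarrow> real) \<Rightarrow> (nat \<Rightarrow> real) \<Rightarrow> nat \<Rightarrow> real" where
  "flip_distance r \<sigma> \<sigma>' k = (\<Sum>i = 1..r. (\<sigma> i - tail_sign r k i * \<sigma>' (flip_tail r k i))\<^sup>2)"

lemma flip_distance_expand:
  assumes "k \<le> r"
  shows "flip_distance r \<sigma> \<sigma>' k = (\<Sum>i = 1..r. (\<sigma> i)\<^sup>2) + (\<Sum>i = 1..r. (\<sigma>' i)\<^sup>2)
    - 2 * (\<Sum>i = 1..r. \<Sum>j = 1..r. signed_flip r k i j * \<sigma> i * \<sigma>' j)"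
proof -
  have "(\<Sum>j = 1..r. signed_flip r k i j * \<sigma> i * \<sigma>' j)
      = tail_sign r k i * \<sigma> i * \<sigma>' (flip_tail r k i)" if "i \<in> {1..r}" for i
  proof -
    have "flip_tail r k i \<in> {1..r}" using bij_betwE[OF bij_flip_tail[OF assms]] that by blast
    moreover have "(\<Sum>j = 1..r. signed_flip r k i j * \<sigma> i * \<sigma>' j)
      = (\<Sum>j = 1..r. if j = flip_tail r k i then tail_sign r k i * \<sigma> i * \<sigma>' j else 0)"
      by (rule sum.cong) (auto simp: signed_flip_def)
    ultimately show ?thesis by simp
  qed
  moreover have "(\<Sum>i = 1..r. (\<sigma>' (flip_tail r k i))\<^sup>2) = (\<Sum>i = 1..r. (\<sigma>' i)\<^sup>2)"
    by (rule sum.reindex_bij_betw[OF bij_flip_tail[OF assms]])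
  moreover have "(tail_sign r k i)\<^sup>2 = 1" for i by (simp add: tail_sign_def)
  ultimately show ?thesis
    by (simp add: flip_distance_def power2_diff power_mult_distrib sum.distrib sum_subtractf
        sum_distrib_left mult_ac)
qed

lemma flip_distance_eq:
  assumes "k \<le> r"
  shows "flip_distance r \<sigma> \<sigma>' k = (\<Sum>j = 1..r - k. (\<sigma> j - \<sigma>' j)\<^sup>2) +
          (\<Sum>j = 1..k. (\<sigma> (r + 1 - j) + \<sigma>' (r - k + j))\<^sup>2)"
proof -
  have "(\<Sum>i \<in> {r - k<..r}. (\<sigma> i - tail_sign r k i * \<sigma>' (flip_tail r k i))\<^sup>2)
      = (\<Sum>j = 1..k. (\<sigma> (r + 1 - j) + \<sigma>' (r - k + j))\<^sup>2)"
    by (rule sum.reindex_bij_witness[where i = "\<lambda>j. r + 1 - j" and j = "\<lambda>i. r + 1 - i"])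
       (use assms in \<open>auto simp: tail_sign_def flip_tail_def mult_2\<close>)
  moreover have "(\<Sum>i = 1..r - k. (\<sigma> i - tail_sign r k i * \<sigma>' (flip_tail r k i))\<^sup>2)
      = (\<Sum>j = 1..r - k. (\<sigma> j - \<sigma>' j)\<^sup>2)"
    by (rule sum.cong) (auto simp: tail_sign_def flip_tail_def)
  ultimately show ?thesis
    unfolding flip_distance_def by (subst sum_Icc_split[of "r - k"]) auto
qed

text \<open>
  The difference of the two sides is affine in \<open>W\<close>, and its least value over all arrays that satisfy the
  row and column conditions is attained at one of the extremal pairings; the hypothesis on \<open>K\<close> is the claim
  for exactly those.
\<close>

lemma bilinear_minimum:
  fixes W :: "nat \<Rightarrow> nat \<Rightarrow> real"
  assumes row: "\<And>i. i \<in> {1..r} \<Longrightarrow> (\<Sum>j = 1..r. \<bar>W i j\<bar>) \<le> 1"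
    and col: "\<And>j. j \<in> {1..r} \<Longrightarrow> (\<Sum>i = 1..r. \<bar>W i j\<bar>) \<le> 1"
    and dec: "decreasing_positive r \<sigma>" "decreasing_positive r \<sigma>'"
    and K: "0 \<le> K" "\<And>k. k \<le> r \<Longrightarrow> 4 * real k \<le> K * flip_distance r \<sigma> \<sigma>' k"
  shows "2 * r - 2 * (\<Sum>i = 1..r. \<Sum>j = 1..r. W i j)
    \<le> K * ((\<Sum>i = 1..r. (\<sigma> i)\<^sup>2) + (\<Sum>i = 1..r. (\<sigma>' i)\<^sup>2)
        - 2 * (\<Sum>i = 1..r. \<Sum>j = 1..r. W i j * \<sigma> i * \<sigma>' j))" (is "?l \<le> K * (?N - 2 * ?B)")
proof -
  \<comment> \<open>The array behaves like one with \<open>q\<close> negative pairs; \<open>q\<close> is interpolated between integers.\<close>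
  define q where "q = (r - (\<Sum>i = 1..r. \<Sum>j = 1..r. W i j)) / 2"
  define k where "k = nat \<lfloor>q\<rfloor>"
  define \<theta> where "\<theta> = q - k"
  have "\<bar>\<Sum>i = 1..r. \<Sum>j = 1..r. W i j\<bar> \<le> (\<Sum>i = 1..r. \<Sum>j = 1..r. \<bar>W i j\<bar>)"
    by (rule order_trans[OF sum_abs sum_mono]) (rule sum_abs)
  also have "\<dots> \<le> (\<Sum>i = 1..r. 1)" by (rule sum_mono) (rule row)
  finally have q: "0 \<le> q" "q \<le> r" by (auto simp: q_def abs_le_iff)
  have "real k \<le> q" "q < real k + 1" using q by (auto simp: k_def)
  hence \<theta>: "0 \<le> \<theta>" "\<theta> \<le> 1" and kr: "k + 1 \<le> r \<or> k \<le> r \<and> \<theta> = 0" using q by (auto simp: \<theta>_def)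
  have kq: "q = k + \<theta>" by (simp add: \<theta>_def)
  let ?G = "\<lambda>k. \<Sum>i = 1..r. \<Sum>j = 1..r. signed_flip r k i j * \<sigma> i * \<sigma>' j"
  have bound: "t * (4 * real l) \<le> K * (t * (?N - 2 * ?G l))" if "0 \<le> t" "l \<le> r \<or> t = 0" for t l
    using that mult_left_mono[OF K(2)[of l], of t]
    by (cases "t = 0") (auto simp: flip_distance_expand mult.left_commute)
  have Wq: "(\<Sum>i = 1..r. \<Sum>j = 1..r. W i j) = r - 2 * (k + \<theta>)"
    unfolding kq[symmetric] by (simp add: q_def field_simps)
  have "?B \<le> (1 - \<theta>) * ?G k + \<theta> * ?G (k + 1)"
    using row col by (intro bilinear_sum_le_signed_flips[OF _ _ Wq \<theta> kr dec])
  hence B: "(1 - \<theta>) * (?N - 2 * ?G k) + \<theta> * (?N - 2 * ?G (k + 1)) \<le> ?N - 2 * ?B"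
    by (simp add: algebra_simps)
  have "?l = 4 * q" by (simp add: q_def)
  also have "\<dots> = (1 - \<theta>) * (4 * real k) + \<theta> * (4 * real (k + 1))"
    by (simp add: kq algebra_simps)
  also have "\<dots> \<le> K * ((1 - \<theta>) * (?N - 2 * ?G k)) + K * (\<theta> * (?N - 2 * ?G (k + 1)))"
    using \<theta> kr by (intro add_mono bound) auto
  also have "\<dots> = K * ((1 - \<theta>) * (?N - 2 * ?G k) + \<theta> * (?N - 2 * ?G (k + 1)))"
    by (simp add: distrib_left)
  also have "\<dots> \<le> K * (?N - 2 * ?B)" by (rule mult_left_mono[OF B K(1)])
  finally show ?thesis .
qed

section \<open>Frobenius distance of singular expansions\<close>

definition overlap :: "nat \<Rightarrow> (nat \<Rightarrow> nat \<Rightarrow> complex) \<Rightarrow> (nat \<Rightarrow> nat \<Rightarrow> complex) \<Rightarrow> nat \<Rightarrow> nat \<Rightarrow> complex" where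
  "overlap d u w i j = (\<Sum>a<d. u i a * cnj (w j a))"

definition orthonormal_family :: "nat \<Rightarrow> nat \<Rightarrow> (nat \<Rightarrow> nat \<Rightarrow> complex) \<Rightarrow> bool" where
  "orthonormal_family d r u \<longleftrightarrow>
    (\<forall>i \<in> {1..r}. \<forall>j \<in> {1..r}. overlap d u u i j = of_bool (i = j))"

lemma overlap_cnj: "cnj (overlap d u w i j) = overlap d w u j i"
  by (simp add: overlap_def mult.commute)

text \<open>
  The residual of \<open>u i\<close> after projection onto the orthonormal family has nonnegative squared norm.
\<close>

lemma bessel:
  assumes w: "orthonormal_family d r w"
  shows "(\<Sum>j = 1..r. (cmod (overlap d u w i j))\<^sup>2) \<le> (\<Sum>a<d. (cmod (u i a))\<^sup>2)"
proof -
  define c where "c j = overlap d u w i j" for j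
  define g where "g a = (\<Sum>j = 1..r. c j * w j a)" for a
  have fg: "(\<Sum>a<d. u i a * cnj (g a)) = (\<Sum>j = 1..r. c j * cnj (c j))"
  proof -
    have "(\<Sum>a<d. u i a * cnj (g a)) = (\<Sum>a<d. \<Sum>j = 1..r. cnj (c j) * (u i a * cnj (w j a)))"
      by (simp add: g_def sum_distrib_left mult_ac)
    also have "\<dots> = (\<Sum>j = 1..r. cnj (c j) * c j)"
      by (subst sum.swap) (simp add: sum_distrib_left[symmetric] c_def overlap_def)
    finally show ?thesis by (simp add: mult.commute)
  qed
  have gg: "(\<Sum>a<d. g a * cnj (g a)) = (\<Sum>j = 1..r. c j * cnj (c j))"
  proof -
    have "(\<Sum>a<d. g a * cnj (g a))
        = (\<Sum>a<d. \<Sum>j = 1..r. \<Sum>k = 1..r. (c j * cnj (c k)) * (w j a * cnj (w k a)))"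
      by (simp add: g_def sum_product mult_ac)
    also have "\<dots> = (\<Sum>j = 1..r. \<Sum>k = 1..r. (c j * cnj (c k)) * overlap d w w j k)"
      by (subst sum.swap, rule sum.cong[OF refl], subst sum.swap)
         (simp add: sum_distrib_left overlap_def)
    also have "\<dots> = (\<Sum>j = 1..r. \<Sum>k = 1..r. if j = k then c j * cnj (c k) else 0)"
      using w by (intro sum.cong refl) (auto simp: orthonormal_family_def)
    finally show ?thesis by simp
  qed
  have gf: "(\<Sum>a<d. g a * cnj (u i a)) = (\<Sum>j = 1..r. c j * cnj (c j))"
    using arg_cong[OF fg, of cnj] by (simp add: mult.commute)
  have "of_real (\<Sum>a<d. (cmod (u i a - g a))\<^sup>2)
      = (\<Sum>a<d. u i a * cnj (u i a)) - (\<Sum>a<d. u i a * cnj (g a))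
        - (\<Sum>a<d. g a * cnj (u i a)) + (\<Sum>a<d. g a * cnj (g a))"
    unfolding of_real_sum complex_norm_square
    by (simp add: sum_subtractf[symmetric] sum.distrib[symmetric] algebra_simps)
  also have "\<dots> = of_real ((\<Sum>a<d. (cmod (u i a))\<^sup>2) - (\<Sum>j = 1..r. (cmod (c j))\<^sup>2))"
    unfolding of_real_sum of_real_diff complex_norm_square fg gg gf by simp
  finally have "(\<Sum>a<d. (cmod (u i a))\<^sup>2) - (\<Sum>j = 1..r. (cmod (c j))\<^sup>2)
      = (\<Sum>a<d. (cmod (u i a - g a))\<^sup>2)" by (simp only: of_real_eq_iff)
  moreover have "0 \<le> (\<Sum>a<d. (cmod (u i a - g a))\<^sup>2)" by (simp add: sum_nonneg)
  ultimately show ?thesis by (simp add: c_def)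
qed

lemma orthonormal_norm:
  assumes "orthonormal_family d r u" "i \<in> {1..r}"
  shows "(\<Sum>a<d. (cmod (u i a))\<^sup>2) = 1"
proof -
  have "of_real (\<Sum>a<d. (cmod (u i a))\<^sup>2) = overlap d u u i i"
    unfolding of_real_sum complex_norm_square overlap_def ..
  also have "\<dots> = of_real 1" using assms by (auto simp: orthonormal_family_def)
  finally show ?thesis by (simp only: of_real_eq_iff)
qed

text \<open>
  By the inequality of arithmetic and geometric means the sum is at most the mean of two Bessel sums.
  Column sums follow by exchanging the two pairs of families.
\<close>

lemma overlap_product_row_sum:
  assumes "orthonormal_family m r u" "orthonormal_family m r w"
    and "orthonormal_family n r v" "orthonormal_family n r x" and i: "i \<in> {1..r}"
  shows "(\<Sum>j = 1..r. \<bar>Re (overlap m u w i j * cnj (overlap n v x i j))\<bar>) \<le> 1"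
proof -
  have "\<bar>Re (y * cnj z)\<bar> \<le> ((cmod y)\<^sup>2 + (cmod z)\<^sup>2) / 2" for y z
  proof -
    have "\<bar>Re (y * cnj z)\<bar> \<le> cmod y * cmod z"
      using abs_Re_le_cmod[of "y * cnj z"] by (simp add: norm_mult)
    also have "\<dots> \<le> ((cmod y)\<^sup>2 + (cmod z)\<^sup>2) / 2"
      using sum_squares_bound[of "cmod y" "cmod z"] by simp
    finally show ?thesis .
  qed
  hence "(\<Sum>j = 1..r. \<bar>Re (overlap m u w i j * cnj (overlap n v x i j))\<bar>)
      \<le> (\<Sum>j = 1..r. ((cmod (overlap m u w i j))\<^sup>2 + (cmod (overlap n v x i j))\<^sup>2) / 2)"
    by (intro sum_mono)
  also have "\<dots> = ((\<Sum>j = 1..r. (cmod (overlap m u w i j))\<^sup>2)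
      + (\<Sum>j = 1..r. (cmod (overlap n v x i j))\<^sup>2)) / 2"
    by (simp add: sum.distrib add_divide_distrib sum_divide_distrib)
  also have "\<dots> \<le> (1 + 1) / 2"
    using bessel[OF assms(2), of u i] bessel[OF assms(4), of v i]
      orthonormal_norm[OF assms(1) i] orthonormal_norm[OF assms(3) i] by simp
  finally show ?thesis by simp
qed

text \<open>
  The entry at \<open>(a, b)\<close> of the matrix \<open>\<Sum>\<^sub>i s\<^sub>i u\<^sub>i v\<^sub>i\<^sup>*\<close>.  Matrices are handled through their
  entries here, which keeps the computation with sums free of dimension side conditions.
\<close>

definition singular_expansion ::
    "nat \<Rightarrow> (nat \<Rightarrow> real) \<Rightarrow> (nat \<Rightarrow> nat \<Rightarrow> complex) \<Rightarrow> (nat \<Rightarrow> nat \<Rightarrow> complex) \<Rightarrow> nat \<Rightarrow> nat \<Rightarrow> complex" where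
  "singular_expansion r s u v a b = (\<Sum>i = 1..r. of_real (s i) * u i a * cnj (v i b))"

lemma singular_expansion_inner:
  "(\<Sum>a<m. \<Sum>b<n. singular_expansion r s u v a b * cnj (singular_expansion r t w x a b))
    = (\<Sum>i = 1..r. \<Sum>j = 1..r. of_real (s i * t j) * (overlap m u w i j * cnj (overlap n v x i j)))"
proof -
  have "(\<Sum>a<m. \<Sum>b<n. singular_expansion r s u v a b * cnj (singular_expansion r t w x a b))
      = (\<Sum>a<m. \<Sum>b<n. \<Sum>i = 1..r. \<Sum>j = 1..r.
          of_real (s i * t j) * (u i a * cnj (w j a)) * cnj (v i b * cnj (x j b)))"
    by (simp add: singular_expansion_def sum_product mult_ac)
  also have "\<dots> = (\<Sum>a<m. \<Sum>i = 1..r. \<Sum>b<n. \<Sum>j = 1..r.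
          of_real (s i * t j) * (u i a * cnj (w j a)) * cnj (v i b * cnj (x j b)))"
    by (intro sum.cong refl sum.swap)
  also have "\<dots> = (\<Sum>i = 1..r. \<Sum>a<m. \<Sum>b<n. \<Sum>j = 1..r.
          of_real (s i * t j) * (u i a * cnj (w j a)) * cnj (v i b * cnj (x j b)))"
    by (rule sum.swap)
  also have "\<dots> = (\<Sum>i = 1..r. \<Sum>a<m. \<Sum>j = 1..r. \<Sum>b<n.
          of_real (s i * t j) * (u i a * cnj (w j a)) * cnj (v i b * cnj (x j b)))"
    by (intro sum.cong refl sum.swap)
  also have "\<dots> = (\<Sum>i = 1..r. \<Sum>j = 1..r. \<Sum>a<m. \<Sum>b<n.
          of_real (s i * t j) * (u i a * cnj (w j a)) * cnj (v i b * cnj (x j b)))"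
    by (intro sum.cong refl sum.swap)
  also have "\<dots> = (\<Sum>i = 1..r. \<Sum>j = 1..r.
      of_real (s i * t j) * (overlap m u w i j * cnj (overlap n v x i j)))"
    by (simp only: overlap_def cnj_sum sum_product) (simp only: sum_distrib_left mult.assoc)
  finally show ?thesis .
qed

lemma singular_expansion_norm:
  assumes "orthonormal_family m r u" "orthonormal_family n r v"
  shows "(\<Sum>a<m. \<Sum>b<n. (cmod (singular_expansion r s u v a b))\<^sup>2) = (\<Sum>i = 1..r. (s i)\<^sup>2)"
proof -
  have "of_real (\<Sum>a<m. \<Sum>b<n. (cmod (singular_expansion r s u v a b))\<^sup>2)
      = (\<Sum>i = 1..r. \<Sum>j = 1..r. of_real (s i * s j) * (overlap m u u i j * cnj (overlap n v v i j)))"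
    unfolding of_real_sum complex_norm_square by (rule singular_expansion_inner)
  also have "\<dots> = (\<Sum>i = 1..r. \<Sum>j = 1..r. if i = j then of_real (s i * s j) else 0)"
    using assms by (intro sum.cong refl) (auto simp: orthonormal_family_def)
  also have "\<dots> = of_real (\<Sum>i = 1..r. (s i)\<^sup>2)" by (simp add: power2_eq_square)
  finally show ?thesis by (simp only: of_real_eq_iff)
qed

lemma singular_expansion_distance:
  assumes on: "orthonormal_family m r u" "orthonormal_family m r w"
    "orthonormal_family n r v" "orthonormal_family n r x"
  shows "(\<Sum>a<m. \<Sum>b<n. (cmod (singular_expansion r s u v a b - singular_expansion r t w x a b))\<^sup>2)
    = (\<Sum>i = 1..r. (s i)\<^sup>2) + (\<Sum>i = 1..r. (t i)\<^sup>2)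
      - 2 * (\<Sum>i = 1..r. \<Sum>j = 1..r.
          Re (overlap m u w i j * cnj (overlap n v x i j)) * s i * t j)"
proof -
  let ?R = "singular_expansion r s u v" and ?T = "singular_expansion r t w x"
  have cmod_diff: "(cmod (y - z))\<^sup>2 = (cmod y)\<^sup>2 + (cmod z)\<^sup>2 - 2 * Re (y * cnj z)" for y z
    by (simp add: cmod_power2 power2_diff algebra_simps)
  have Re_scale: "Re (of_real c * z) = c * Re z" for c z by simp
  have "(\<Sum>a<m. \<Sum>b<n. Re (?R a b * cnj (?T a b)))
      = Re (\<Sum>a<m. \<Sum>b<n. ?R a b * cnj (?T a b))" by simp
  also have "\<dots> = (\<Sum>i = 1..r. \<Sum>j = 1..r.
          Re (overlap m u w i j * cnj (overlap n v x i j)) * s i * t j)"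
    unfolding singular_expansion_inner Re_sum
    by (intro sum.cong refl) (subst Re_scale, simp only: mult_ac)
  finally have inner: "(\<Sum>a<m. \<Sum>b<n. Re (?R a b * cnj (?T a b))) = \<dots>" .
  have "(\<Sum>a<m. \<Sum>b<n. (cmod (?R a b - ?T a b))\<^sup>2)
    = (\<Sum>a<m. \<Sum>b<n. (cmod (?R a b))\<^sup>2) + (\<Sum>a<m. \<Sum>b<n. (cmod (?T a b))\<^sup>2)
      - 2 * (\<Sum>a<m. \<Sum>b<n. Re (?R a b * cnj (?T a b)))"
    by (simp only: cmod_diff sum_subtractf sum.distrib sum_distrib_left)
  thus ?thesis
    unfolding inner singular_expansion_norm[OF on(1,3)] singular_expansion_norm[OF on(2,4)] .
qed

text \<open>
  Both squared distances are affine in the array of the products of overlaps, so this is an instance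
  of the bound for bilinear sums.
\<close>

lemma polar_perturbation_expansion:
  assumes on: "orthonormal_family m r u" "orthonormal_family m r w"
    "orthonormal_family n r v" "orthonormal_family n r x"
    and dec: "decreasing_positive r \<sigma>" "decreasing_positive r \<sigma>'"
    and K: "0 \<le> K" "\<And>k. k \<le> r \<Longrightarrow> 4 * real k \<le> K * flip_distance r \<sigma> \<sigma>' k"
  shows "(\<Sum>a<m. \<Sum>b<n.
      (cmod (singular_expansion r (\<lambda>_. 1) u v a b - singular_expansion r (\<lambda>_. 1) w x a b))\<^sup>2)
    \<le> K * (\<Sum>a<m. \<Sum>b<n.
      (cmod (singular_expansion r \<sigma> u v a b - singular_expansion r \<sigma>' w x a b))\<^sup>2)"
proof -
  let ?W = "\<lambda>i j. Re (overlap m u w i j * cnj (overlap n v x i j))"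
  have row: "(\<Sum>j = 1..r. \<bar>?W i j\<bar>) \<le> 1" if "i \<in> {1..r}" for i
    using overlap_product_row_sum[OF on that] .
  have col: "(\<Sum>i = 1..r. \<bar>?W i j\<bar>) \<le> 1" if "j \<in> {1..r}" for j
  proof -
    have "?W i j = Re (overlap m w u j i * cnj (overlap n x v j i))" for i
    proof -
      have "?W i j = Re (cnj (overlap m u w i j * cnj (overlap n v x i j)))" by (simp only: cnj.simps)
      thus ?thesis by (simp only: complex_cnj_mult overlap_cnj)
    qed
    thus ?thesis using overlap_product_row_sum[OF on(2,1,4,3) that] by simp
  qed
  have "2 * real r - 2 * (\<Sum>i = 1..r. \<Sum>j = 1..r. ?W i j)
    \<le> K * ((\<Sum>i = 1..r. (\<sigma> i)\<^sup>2) + (\<Sum>i = 1..r. (\<sigma>' i)\<^sup>2)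
        - 2 * (\<Sum>i = 1..r. \<Sum>j = 1..r. ?W i j * \<sigma> i * \<sigma>' j))"
    using row col by (intro bilinear_minimum dec K)
  thus ?thesis unfolding singular_expansion_distance[OF on] by simp
qed

section \<open>Adjoints and the spectral theorem\<close>

lemma mat_adjoint_index [simp]:
  "i < dim_col A \<Longrightarrow> j < dim_row A \<Longrightarrow> mat_adjoint A $$ (i, j) = cnj (A $$ (j, i))" for A :: "complex mat"
  by (simp add: mat_adjoint_def mat_of_rows_index)

lemma mat_adjoint_dim [simp]:
  "dim_row (mat_adjoint A) = dim_col A" "dim_col (mat_adjoint A) = dim_row A"
  by (auto simp: mat_adjoint_def)

lemma mat_adjoint_carrier [simp]: "A \<in> carrier_mat m n \<Longrightarrow> mat_adjoint A \<in> carrier_mat n m"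
  by (auto intro: carrier_matI)

lemma mat_adjoint_adjoint [simp]: "mat_adjoint (mat_adjoint A) = A" for A :: "complex mat"
  by (rule eq_matI) auto

lemma mat_mult_index:
  "A \<in> carrier_mat m k \<Longrightarrow> B \<in> carrier_mat k n \<Longrightarrow> i < m \<Longrightarrow> j < n \<Longrightarrow>
    (A * B) $$ (i, j) = (\<Sum>l<k. A $$ (i, l) * B $$ (l, j))"
  by (auto simp: scalar_prod_def atLeast0LessThan)

lemma adjoint_mult_index:
  fixes A B :: "complex mat"
  assumes "A \<in> carrier_mat k m" "B \<in> carrier_mat k n" "i < m" "j < n"
  shows "(mat_adjoint A * B) $$ (i, j) = (\<Sum>l<k. cnj (A $$ (l, i)) * B $$ (l, j))"
  using assms by (subst mat_mult_index[of _ m k _ n]) auto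

lemma mult_adjoint_index:
  fixes A B :: "complex mat"
  assumes "A \<in> carrier_mat m k" "B \<in> carrier_mat n k" "i < m" "j < n"
  shows "(A * mat_adjoint B) $$ (i, j) = (\<Sum>l<k. A $$ (i, l) * cnj (B $$ (j, l)))"
  using assms by (subst mat_mult_index[of _ m k _ n]) auto

lemma mat_adjoint_mult:
  fixes A B :: "complex mat"
  assumes A: "A \<in> carrier_mat m k" and B: "B \<in> carrier_mat k n"
  shows "mat_adjoint (A * B) = mat_adjoint B * mat_adjoint A"
proof (rule eq_matI)
  fix i j assume "i < dim_row (mat_adjoint B * mat_adjoint A)" "j < dim_col (mat_adjoint B * mat_adjoint A)"
  hence ij: "i < n" "j < m" using A B by auto
  have "mat_adjoint (A * B) $$ (i, j) = cnj ((A * B) $$ (j, i))" using ij A B by simp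
  also have "\<dots> = (mat_adjoint B * mat_adjoint A) $$ (i, j)"
    using ij A B by (subst mat_mult_index[OF A B], simp, simp, subst adjoint_mult_index[OF B mat_adjoint_carrier[OF A]])
      (auto simp: mult.commute)
  finally show "mat_adjoint (A * B) $$ (i, j) = (mat_adjoint B * mat_adjoint A) $$ (i, j)" .
qed (use A B in auto)

lemma cscalar_prod_sum:
  "x \<in> carrier_vec n \<Longrightarrow> y \<in> carrier_vec n \<Longrightarrow> x \<bullet>c y = (\<Sum>i<n. x $ i * cnj (y $ i))"
  by (auto simp: scalar_prod_def atLeast0LessThan)

lemma adjoint_cscalar_prod:
  fixes A :: "complex mat"
  assumes A: "A \<in> carrier_mat m n" and x: "x \<in> carrier_vec n" and y: "y \<in> carrier_vec m"
  shows "(A *\<^sub>v x) \<bullet>c y = x \<bullet>c (mat_adjoint A *\<^sub>v y)"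
proof -
  have "(A *\<^sub>v x) \<bullet>c y = (\<Sum>i<m. \<Sum>j<n. A $$ (i, j) * x $ j * cnj (y $ i))"
    using assms
    by (subst cscalar_prod_sum[of _ m]) (auto simp: scalar_prod_def atLeast0LessThan sum_distrib_right)
  also have "\<dots> = (\<Sum>j<n. \<Sum>i<m. A $$ (i, j) * x $ j * cnj (y $ i))" by (rule sum.swap)
  also have "\<dots> = x \<bullet>c (mat_adjoint A *\<^sub>v y)"
    using assms mult_mat_vec_carrier[OF mat_adjoint_carrier[OF A] y]
    by (subst cscalar_prod_sum[of _ n])
       (auto simp: scalar_prod_def atLeast0LessThan sum_distrib_left mult_ac intro!: sum.cong)
  finally show ?thesis .
qed

definition unitary :: "nat \<Rightarrow> complex mat \<Rightarrow> bool" where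
  "unitary n P \<longleftrightarrow> P \<in> carrier_mat n n \<and> mat_adjoint P * P = 1\<^sub>m n"

lemma unitaryD:
  assumes "unitary n P"
  shows "P \<in> carrier_mat n n" "mat_adjoint P \<in> carrier_mat n n"
    "mat_adjoint P * P = 1\<^sub>m n" "P * mat_adjoint P = 1\<^sub>m n"
  using assms mat_mult_left_right_inverse[of "mat_adjoint P" n P] by (auto simp: unitary_def)

lemma unitary_mult:
  assumes P: "unitary n P" and R: "unitary n R"
  shows "unitary n (P * R)"
proof -
  note [simp] = unitaryD[OF P] unitaryD[OF R]
  have "mat_adjoint (P * R) * (P * R) = mat_adjoint R * (mat_adjoint P * P) * R"
    by (simp add: mat_adjoint_mult[of P n n R n] assoc_mult_mat[of _ n n _ n _ n]
        mult_carrier_mat[of _ n n _ n] del: unitaryD(3)[OF P])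
  also have "\<dots> = 1\<^sub>m n"
    by (simp add: right_mult_one_mat[of _ n n])
  finally show ?thesis by (simp add: unitary_def mult_carrier_mat[of _ n n])
qed

text \<open>
  Gram-Schmidt orthogonalisation of a basis that starts with \<open>v\<close>, followed by normalisation of
  the columns.
\<close>

lemma unitary_completion:
  assumes v: "v \<in> carrier_vec n" "v \<noteq> 0\<^sub>v n"
  obtains W c where "unitary n W" "col W 0 = c \<cdot>\<^sub>v v"
proof -
  interpret cof_vec_space n "TYPE(complex)" .
  define b where "b = basis_completion v"
  define ws where "ws = gram_schmidt n b"
  from basis_completion[OF v, folded b_def]
  have dist_b: "distinct b" and indep: "\<not> lin_dep (set b)" and b: "set b \<subseteq> carrier_vec n"
    and hdb: "hd b = v" and len_b: "length b = n" by auto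
  have n: "n \<noteq> 0" using v by (auto)
  from hdb len_b n obtain vs where bv: "b = v # vs" by (cases b, auto)
  from gram_schmidt_result[OF b dist_b indep refl, folded ws_def]
  have ws: "set ws \<subseteq> carrier_vec n" "corthogonal ws" "length ws = n" by (auto simp: len_b)
  have hdws: "ws ! 0 = v"
    using gram_schmidt_hd[OF v(1), of vs, folded bv] ws n unfolding ws_def by (metis hd_conv_nth length_0_conv)
  have wsc: "ws ! j \<in> carrier_vec n" if "j < n" for j using ws that by auto
  define l where "l j = complex_of_real (sqrt (Re (ws ! j \<bullet>c ws ! j)))" for j
  have l: "l j * l j = ws ! j \<bullet>c ws ! j" "l j \<noteq> 0" "cnj (l j) = l j" if "j < n" for j
  proof -
    have "ws ! j \<bullet>c ws ! j \<noteq> 0" using corthogonalD[OF ws(2), of j j] that ws by auto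
    moreover have "0 \<le> ws ! j \<bullet>c ws ! j" by (rule conjugate_square_ge_0_vec)
    ultimately have "0 < Re (ws ! j \<bullet>c ws ! j)" "Im (ws ! j \<bullet>c ws ! j) = 0"
      by (auto simp: less_eq_complex_def complex_eq_iff)
    thus "l j * l j = ws ! j \<bullet>c ws ! j" "l j \<noteq> 0" "cnj (l j) = l j"
      by (auto simp: l_def of_real_mult[symmetric] complex_eq_iff simp del: of_real_mult)
  qed
  define W where "W = mat n n (\<lambda>(i, j). ws ! j $ i / l j)"
  have W: "W \<in> carrier_mat n n" by (simp add: W_def)
  have "mat_adjoint W * W = 1\<^sub>m n"
  proof (rule eq_matI)
    fix i j assume "i < dim_row (1\<^sub>m n)" "j < dim_col (1\<^sub>m n)"
    hence ij: "i < n" "j < n" by auto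
    have "(mat_adjoint W * W) $$ (i, j) = (\<Sum>k<n. (ws ! j $ k * cnj (ws ! i $ k)) / (l i * l j))"
      by (subst adjoint_mult_index[OF W W ij], rule sum.cong) (use ij in \<open>auto simp: W_def l\<close>)
    also have "\<dots> = (ws ! j \<bullet>c ws ! i) / (l i * l j)"
      by (simp add: cscalar_prod_sum[OF wsc wsc] ij sum_divide_distrib)
    also have "\<dots> = 1\<^sub>m n $$ (i, j)"
      using ij l[of j] corthogonalD[OF ws(2), of j i] ws(3) by (cases "i = j") auto
    finally show "(mat_adjoint W * W) $$ (i, j) = 1\<^sub>m n $$ (i, j)" .
  qed (use W in auto)
  hence "unitary n W" using W by (simp add: unitary_def)
  moreover have "col W 0 = (1 / l 0) \<cdot>\<^sub>v v"
    using n v(1) by (intro eq_vecI) (auto simp: W_def hdws)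
  ultimately show ?thesis by (rule that)
qed

definition rect_diag :: "nat \<Rightarrow> nat \<Rightarrow> (nat \<Rightarrow> complex) \<Rightarrow> complex mat" where
  "rect_diag m n d = mat m n (\<lambda>(i, j). if i = j then d i else 0)"

lemma rect_diag_carrier [simp]: "rect_diag m n d \<in> carrier_mat m n"
  and rect_diag_index [simp]: "i < m \<Longrightarrow> j < n \<Longrightarrow> rect_diag m n d $$ (i, j) = (if i = j then d i else 0)"
  and rect_diag_dim [simp]: "dim_row (rect_diag m n d) = m" "dim_col (rect_diag m n d) = n"
  by (auto simp: rect_diag_def)

lemma unitary_conj_cancel:
  assumes P: "unitary n P" and A: "A \<in> carrier_mat n n" and D: "mat_adjoint P * A * P = D"
  shows "A * P = P * D"
proof -
  note [simp] = unitaryD[OF P] A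
  have "P * D = (P * mat_adjoint P) * (A * P)"
    unfolding D[symmetric] by (simp add: assoc_mult_mat[of _ n n _ n _ n] mult_carrier_mat[of _ n n] del: unitaryD(4)[OF P])
  thus ?thesis by (simp add: left_mult_one_mat[OF mult_carrier_mat[OF A unitaryD(1)[OF P]]])
qed

lemma block_diag_mult:
  assumes F: "F\<^sub>1 \<in> carrier_mat k k" "F\<^sub>2 \<in> carrier_mat k k"
    and G: "G\<^sub>1 \<in> carrier_mat n n" "G\<^sub>2 \<in> carrier_mat n n"
  shows "four_block_mat F\<^sub>1 (0\<^sub>m k n) (0\<^sub>m n k) G\<^sub>1 * four_block_mat F\<^sub>2 (0\<^sub>m k n) (0\<^sub>m n k) G\<^sub>2
    = four_block_mat (F\<^sub>1 * F\<^sub>2) (0\<^sub>m k n) (0\<^sub>m n k) (G\<^sub>1 * G\<^sub>2)"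
proof -
  have "F\<^sub>1 * F\<^sub>2 + 0\<^sub>m k n * 0\<^sub>m n k = F\<^sub>1 * F\<^sub>2"
    using mult_carrier_mat[OF F] by simp
  moreover have "F\<^sub>1 * 0\<^sub>m k n + 0\<^sub>m k n * G\<^sub>2 = 0\<^sub>m k n" "0\<^sub>m n k * F\<^sub>2 + G\<^sub>1 * 0\<^sub>m n k = 0\<^sub>m n k"
    by (simp_all add: right_mult_zero_mat[OF F(1)] left_mult_zero_mat[OF G(2)]
        right_mult_zero_mat[OF G(1)] left_mult_zero_mat[OF F(2)])
  moreover have "0\<^sub>m n k * 0\<^sub>m k n + G\<^sub>1 * G\<^sub>2 = G\<^sub>1 * G\<^sub>2"
    using mult_carrier_mat[OF G] by simp
  ultimately show ?thesis
    by (subst mult_four_block_mat[OF F(1) zero_carrier_mat zero_carrier_mat G(1)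
          F(2) zero_carrier_mat zero_carrier_mat G(2)]) simp
qed

text \<open>
  Deflation: conjugating with a unitary matrix whose first column is an eigenvector for \<open>e\<close> produces
  the first column \<open>(e, 0, \<dots>, 0)\<close>; the first row has the same form because the matrix stays
  Hermitian, and the induction hypothesis applies to the remaining block.  The eigenvalues appear in
  the order of the given list, so that later the nonzero singular values can be put first, in
  decreasing order.
\<close>

lemma hermitian_spectral:
  assumes "A \<in> carrier_mat n n" "mat_adjoint A = A"
    and "char_poly A = (\<Prod>e\<leftarrow>es. [:- e, 1:])"
  shows "\<exists>P. unitary n P \<and> mat_adjoint P * A * P = rect_diag n n (\<lambda>i. es ! i)"
  using assms
proof (induction es arbitrary: n A)
  case Nil
  with degree_monic_char_poly[of A n] have n: "n = 0" by auto
  have "unitary n (1\<^sub>m n)" unfolding n unitary_def by (auto intro!: eq_matI)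
  thus ?case using Nil(1) by (intro exI[of _ "1\<^sub>m n"]) (auto simp: n intro!: eq_matI)
next
  case (Cons e es n' A)
  note herm = Cons.prems(2)
  have mon: "monic (\<Prod>e\<leftarrow>es. [:- e, 1:])" by (rule monic_prod_list) auto
  have cp: "char_poly A = [:- e, 1:] * (\<Prod>e\<leftarrow>es. [:- e, 1:])" using Cons.prems(3) by simp
  have "degree (char_poly A) = Suc (degree (\<Prod>e\<leftarrow>es. [:- e, 1:]))"
    unfolding cp by (subst degree_mult_eq, insert mon, auto)
  with degree_monic_char_poly[OF Cons.prems(1)] obtain n where n': "n' = Suc n" by metis
  have A: "A \<in> carrier_mat (Suc n) (Suc n)" using Cons.prems(1) n' by simp
  have "eigenvalue A e" unfolding eigenvalue_root_char_poly[OF A] Cons.prems(3) by simp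
  then obtain v where v: "v \<in> carrier_vec (Suc n)" "v \<noteq> 0\<^sub>v (Suc n)" and Av: "A *\<^sub>v v = e \<cdot>\<^sub>v v"
    using A by (auto simp: eigenvalue_def eigenvector_def)
  obtain W c where W: "unitary (Suc n) W" and W0: "col W 0 = c \<cdot>\<^sub>v v"
    using unitary_completion[OF v] .
  note Wc [simp] = unitaryD(1,2)[OF W] and WW = unitaryD(3,4)[OF W] and [simp] = A
  \<comment> \<open>\<open>B\<close> will be block diagonal with blocks \<open>E = (e)\<close> and \<open>C\<close>.\<close>
  define B where "B = mat_adjoint W * A * W"
  have B: "B \<in> carrier_mat (Suc n) (Suc n)" by (simp add: B_def mult_carrier_mat[of _ "Suc n" "Suc n"])
  have B_alt: "B = mat_adjoint W * (A * W)"
    unfolding B_def by (simp add: assoc_mult_mat[of _ "Suc n" "Suc n" _ "Suc n" _ "Suc n"])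
  have hB: "mat_adjoint B = B"
    unfolding B_def
    by (simp add: mat_adjoint_mult[of _ "Suc n" "Suc n" _ "Suc n"] mult_carrier_mat[of _ "Suc n" "Suc n"] herm
       assoc_mult_mat[of _ "Suc n" "Suc n" _ "Suc n" _ "Suc n"])
  have colB: "col B 0 = e \<cdot>\<^sub>v unit_vec (Suc n) 0"
  proof -
    have "col (A * W) 0 = e \<cdot>\<^sub>v col W 0"
      using v(1) by (simp add: col_mult2[OF A Wc(1)] W0 mult_mat_vec[OF A] Av smult_smult_assoc mult.commute)
    hence "col B 0 = mat_adjoint W *\<^sub>v (e \<cdot>\<^sub>v col W 0)"
      unfolding B_alt by (subst col_mult2[OF Wc(2) mult_carrier_mat[OF A Wc(1)]]) auto
    also have "\<dots> = e \<cdot>\<^sub>v col (mat_adjoint W * W) 0"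
      using carrier_matD[OF Wc(1)]
      by (simp add: col_mult2[OF Wc(2) Wc(1)] mult_mat_vec[OF Wc(2)] carrier_vecI)
    finally show ?thesis by (simp add: WW)
  qed
  have B0: "B $$ (i, 0) = (if i = 0 then e else 0)" if "i < Suc n" for i
    using arg_cong[OF colB, of "\<lambda>v. v $ i"] that B by (auto simp: unit_vec_def)
  have B0': "B $$ (0, i) = (if i = 0 then e else 0)" if "i < Suc n" for i
  proof -
    have "B $$ (0, i) = cnj (B $$ (i, 0))"
      using that B by (subst hB[symmetric]) auto
    moreover have "cnj e = e"
      using B0[of 0] arg_cong[OF hB, of "\<lambda>M. M $$ (0, 0)"] B by simp
    ultimately show ?thesis using B0[OF that] by simp
  qed
  define C where "C = mat n n (\<lambda>(i, j). B $$ (Suc i, Suc j))"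
  have C: "C \<in> carrier_mat n n" by (simp add: C_def)
  have hC: "mat_adjoint C = C"
  proof (rule eq_matI)
    fix i j assume "i < dim_row C" "j < dim_col C"
    hence ij: "i < n" "j < n" using C by auto
    have "B $$ (Suc i, Suc j) = cnj (B $$ (Suc j, Suc i))"
      using ij B by (subst hB[symmetric]) auto
    thus "mat_adjoint C $$ (i, j) = C $$ (i, j)" using ij by (simp add: C_def)
  qed (use C in auto)
  define E where "E = mat 1 1 (\<lambda>_. e)"
  have E: "E \<in> carrier_mat 1 1" by (simp add: E_def)
  have block: "B = four_block_mat E (0\<^sub>m 1 n) (0\<^sub>m n 1) C"
    using B by (intro eq_matI) (auto simp: B0 B0' C_def E_def less_Suc_eq_0_disj)
  have "similar_mat_wit B A (mat_adjoint W) W"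
    by (rule similar_mat_witI[OF WW B_def B A Wc(2,1)])
  hence "char_poly B = char_poly A"
    by (intro char_poly_similar) (auto simp: similar_mat_def)
  hence "char_poly A = char_poly B" ..
  also have "\<dots> = char_poly E * char_poly C"
    unfolding block by (rule char_poly_four_block_zeros_col[OF E _ C]) simp
  also have "char_poly E = [:- e, 1:]" by (simp add: E_def char_poly_defs det_def sign_def)
  finally have "[:- e, 1:] * char_poly C = [:- e, 1:] * (\<Prod>e\<leftarrow>es. [:- e, 1:])"
    unfolding cp ..
  hence "char_poly C = (\<Prod>e\<leftarrow>es. [:- e, 1:])"
    by (subst (asm) mult_cancel_left) simp
  from Cons.IH[OF C hC this] obtain P where P: "unitary n P"
    and PC: "mat_adjoint P * C * P = rect_diag n n (\<lambda>i. es ! i)" by blast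
  note Pc [simp] = unitaryD(1,2)[OF P]
  define R where "R = four_block_mat (1\<^sub>m 1) (0\<^sub>m 1 n) (0\<^sub>m n 1) P"
  have R: "R \<in> carrier_mat (Suc n) (Suc n)" using four_block_carrier_mat[OF one_carrier_mat[of 1] Pc(1)] by (simp add: R_def)
  have R': "mat_adjoint R = four_block_mat (1\<^sub>m 1) (0\<^sub>m 1 n) (0\<^sub>m n 1) (mat_adjoint P)"
    unfolding R_def using Pc(1) carrier_matD[OF Pc(1)] by (intro eq_matI) auto
  have RR: "mat_adjoint R * M * R = four_block_mat F (0\<^sub>m 1 n) (0\<^sub>m n 1) (mat_adjoint P * G * P)"
    if M: "M = four_block_mat F (0\<^sub>m 1 n) (0\<^sub>m n 1) G"
      and F: "F \<in> carrier_mat 1 1" and G: "G \<in> carrier_mat n n" for M F G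
  proof -
    have "mat_adjoint R * M = four_block_mat F (0\<^sub>m 1 n) (0\<^sub>m n 1) (mat_adjoint P * G)"
      unfolding R' M block_diag_mult[OF one_carrier_mat F Pc(2) G] left_mult_one_mat[OF F] ..
    thus ?thesis
      using block_diag_mult[OF F one_carrier_mat mult_carrier_mat[OF Pc(2) G] Pc(1)]
      unfolding R_def[symmetric] right_mult_one_mat[OF F] by simp
  qed
  have one_block: "1\<^sub>m (Suc n) = four_block_mat (1\<^sub>m 1) (0\<^sub>m 1 n) (0\<^sub>m n 1) (1\<^sub>m n :: complex mat)"
    by (intro eq_matI) auto
  have "mat_adjoint R * R = mat_adjoint R * 1\<^sub>m (Suc n) * R" using R by simp
  also have "\<dots> = four_block_mat (1\<^sub>m 1) (0\<^sub>m 1 n) (0\<^sub>m n 1) (mat_adjoint P * 1\<^sub>m n * P)"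
    by (rule RR[OF one_block one_carrier_mat one_carrier_mat])
  also have "mat_adjoint P * 1\<^sub>m n * P = 1\<^sub>m n"
    unfolding right_mult_one_mat[OF Pc(2)] by (rule unitaryD(3)[OF P])
  also note one_block[symmetric]
  finally have uR: "unitary (Suc n) R" using R by (simp add: unitary_def)
  have "mat_adjoint (W * R) * A * (W * R) = mat_adjoint R * B * R"
    unfolding B_def using R
    by (simp add: mat_adjoint_mult[of _ "Suc n" "Suc n" _ "Suc n"] mult_carrier_mat[of _ "Suc n" "Suc n"]
       assoc_mult_mat[of _ "Suc n" "Suc n" _ "Suc n" _ "Suc n"])
  also have "\<dots> = four_block_mat E (0\<^sub>m 1 n) (0\<^sub>m n 1) (rect_diag n n (\<lambda>i. es ! i))"
    by (simp only: RR[OF block E C] PC)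
  also have "\<dots> = rect_diag (Suc n) (Suc n) (\<lambda>i. (e # es) ! i)"
    by (intro eq_matI) (auto simp: E_def less_Suc_eq_0_disj split: if_splits)
  finally show ?case unfolding n' using unitary_mult[OF W uR] by blast
qed

text \<open>
  The eigenvalues are values of the quadratic form at unit vectors.
\<close>

lemma hermitian_zero_form:
  fixes A :: "complex mat"
  assumes A: "A \<in> carrier_mat n n" and herm: "mat_adjoint A = A"
    and zero: "\<And>x. x \<in> carrier_vec n \<Longrightarrow> (A *\<^sub>v x) \<bullet>c x = 0"
  shows "A = 0\<^sub>m n n"
proof -
  obtain es where "char_poly A = (\<Prod>e\<leftarrow>es. [:- e, 1:])" using char_poly_factorized[OF A] by blast
  from hermitian_spectral[OF A herm this] obtain P
    where P: "unitary n P" and D: "mat_adjoint P * A * P = rect_diag n n (\<lambda>i. es ! i)" by blast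
  note Pc [simp] = unitaryD(1,2)[OF P]
  have AP: "A * P = P * rect_diag n n (\<lambda>i. es ! i)" by (rule unitary_conj_cancel[OF P A D])
  have "es ! i = 0" if i: "i < n" for i
  proof -
    have "(mat_adjoint P * (A * P)) $$ (i, i) = (\<Sum>l<n. cnj (P $$ (l, i)) * (A * P) $$ (l, i))"
      by (rule adjoint_mult_index[OF Pc(1) mult_carrier_mat[OF A Pc(1)] i i])
    also have "\<dots> = (A *\<^sub>v col P i) \<bullet>c col P i"
      using i A Pc by (subst cscalar_prod_sum[of _ n]) (auto simp: mat_mult_index[OF A Pc(1)] scalar_prod_def
          carrier_matD[OF Pc(1)] atLeast0LessThan mult.commute intro!: sum.cong)
    also have "\<dots> = 0" using i A Pc by (intro zero) auto
    finally have "(mat_adjoint P * A * P) $$ (i, i) = 0"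
      by (simp add: assoc_mult_mat[OF Pc(2) A Pc(1)])
    thus ?thesis using i by (simp add: D)
  qed
  hence "rect_diag n n (\<lambda>i. es ! i) = 0\<^sub>m n n" by (intro eq_matI) auto
  hence "A * P = 0\<^sub>m n n" using AP Pc by simp
  hence "A * P * mat_adjoint P = 0\<^sub>m n n" by (simp add: left_mult_zero_mat[OF Pc(2)])
  thus ?thesis using A Pc unitaryD(4)[OF P] by (simp add: assoc_mult_mat[of _ n n _ n _ n])
qed

section \<open>Singular values as eigenvalues of the Gram matrix\<close>

lemma proots_linear_factors: "proots (\<Prod>e\<leftarrow>es. [:- e, 1:]) = mset es" for es :: "complex list"
proof (induction es)
  case (Cons e es)
  have "(\<Prod>e\<leftarrow>es. [:- e, 1:]) \<noteq> (0 :: complex poly)" by (auto simp: prod_list_zero_iff)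
  thus ?case using Cons by (simp add: proots_mult del: mult_pCons_left)
qed simp

lemma linear_factors_cong: "mset es = mset fs \<Longrightarrow> (\<Prod>e\<leftarrow>es. [:- e, 1:]) = (\<Prod>e\<leftarrow>fs. [:- e, 1:])"
  for es :: "complex list"
  by (metis mset_map prod_mset_prod_list)

text \<open>
  The eigenvalues of \<open>A\<^sup>* A\<close> in the order of the singular values \<open>\<sigma> 1, \<dots>, \<sigma> r\<close>, which are
  indexed from \<open>1\<close>, while matrix columns are indexed from \<open>0\<close>.
\<close>

definition padded_squares :: "nat \<Rightarrow> nat \<Rightarrow> (nat \<Rightarrow> real) \<Rightarrow> complex list" where
  "padded_squares n r \<sigma> = map (\<lambda>i. of_real ((\<sigma> (Suc i))\<^sup>2)) [0..<r] @ replicate (n - r) 0"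

lemma padded_squares_nth:
  assumes "r \<le> n" "c < n"
  shows "padded_squares n r \<sigma> ! c = of_real (if c < r then (\<sigma> (Suc c))\<^sup>2 else 0)"
  using assms by (auto simp: padded_squares_def nth_append)

lemma gram_hermitian: "A \<in> carrier_mat m n \<Longrightarrow> mat_adjoint (mat_adjoint A * A) = mat_adjoint A * A"
  for A :: "complex mat"
  by (simp add: mat_adjoint_mult[of _ n m _ n])

lemma gram_quadratic_form:
  fixes A :: "complex mat"
  assumes A: "A \<in> carrier_mat m n" and x: "x \<in> carrier_vec n"
  shows "((mat_adjoint A * A) *\<^sub>v x) \<bullet>c x = (A *\<^sub>v x) \<bullet>c (A *\<^sub>v x)"
proof -
  have Ax: "A *\<^sub>v x \<in> carrier_vec m" using A x by simp
  have "((mat_adjoint A * A) *\<^sub>v x) \<bullet>c x = (mat_adjoint A *\<^sub>v (A *\<^sub>v x)) \<bullet>c x"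
    by (simp add: assoc_mult_mat_vec[OF mat_adjoint_carrier[OF A] A x])
  also have "\<dots> = (A *\<^sub>v x) \<bullet>c (A *\<^sub>v x)"
    by (simp add: adjoint_cscalar_prod[OF mat_adjoint_carrier[OF A] Ax x])
  finally show ?thesis .
qed

text \<open>
  Singular values are square roots of real parts of eigenvalues, which loses information in general;
  the eigenvalues of \<open>A\<^sup>* A\<close> are recovered from them because the Rayleigh quotient of an eigenvector
  shows that they are real and nonnegative.
\<close>

lemma char_poly_gram:
  assumes A: "A \<in> carrier_mat m n" and sv: "has_nonzero_singular_values A r \<sigma>"
    and pos: "\<And>i. i \<in> {1..r} \<Longrightarrow> 0 < \<sigma> i"
  shows "r \<le> n" "char_poly (mat_adjoint A * A) = (\<Prod>e\<leftarrow>padded_squares n r \<sigma>. [:- e, 1:])"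
proof -
  let ?G = "mat_adjoint A * A"
  have G: "?G \<in> carrier_mat n n" by (rule mult_carrier_mat[OF mat_adjoint_carrier[OF A] A])
  obtain gs where gs: "char_poly ?G = (\<Prod>e\<leftarrow>gs. [:- e, 1:])" and len: "length gs = n"
    using char_poly_factorized[OF G] by blast
  have nonneg: "z = of_real ((sqrt (Re z))\<^sup>2)" if z: "z \<in> set gs" for z
  proof -
    have "poly (char_poly ?G) z = 0" using z unfolding gs by (auto simp: poly_prod_list prod_list_zero_iff)
    hence "eigenvalue ?G z" by (simp add: eigenvalue_root_char_poly[OF G])
    then obtain x where x: "x \<in> carrier_vec n" "x \<noteq> 0\<^sub>v n" and Gx: "?G *\<^sub>v x = z \<cdot>\<^sub>v x"
      using G carrier_matD(1)[OF G] unfolding eigenvalue_def eigenvector_def by auto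
    have "z * (x \<bullet>c x) = (?G *\<^sub>v x) \<bullet>c x"
      unfolding Gx using x by simp
    also have "\<dots> = (A *\<^sub>v x) \<bullet>c (A *\<^sub>v x)" by (rule gram_quadratic_form[OF A x(1)])
    finally have zx: "z * (x \<bullet>c x) = (A *\<^sub>v x) \<bullet>c (A *\<^sub>v x)" .
    have "0 \<le> (A *\<^sub>v x) \<bullet>c (A *\<^sub>v x)" by (rule conjugate_square_ge_0_vec)
    hence "0 \<le> z * (x \<bullet>c x)" unfolding zx .
    moreover have "0 < x \<bullet>c x"
      using x conjugate_square_greater_0_vec[OF x(1)] by simp
    ultimately have "0 \<le> Re z" "Im z = 0"
      by (auto simp: less_eq_complex_def less_complex_def zero_le_mult_iff)
    thus ?thesis by (simp add: complex_eq_iff)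
  qed
  have mset_set_shift: "mset_set {Suc 0..r} = image_mset Suc (mset_set {0..<r})"
    by (simp add: image_mset_mset_set image_Suc_atLeastLessThan atLeastLessThanSuc_atLeastAtMost)
  have proots: "proots (char_poly ?G) = mset gs" unfolding gs by (rule proots_linear_factors)
  let ?f = "\<lambda>z. sqrt (Re z)"
  have nz: "{#s \<in># image_mset ?f (mset gs). s \<noteq> 0#} = image_mset \<sigma> (mset_set {1..r})"
    using sv unfolding has_nonzero_singular_values_def singular_values_def proots .
  have split: "image_mset ?f (mset gs) = image_mset \<sigma> (mset_set {1..r}) + {#s \<in># image_mset ?f (mset gs). s = 0#}"
    unfolding nz[symmetric] by (rule multiset_eqI) auto
  have size: "n = r + count (image_mset ?f (mset gs)) 0"
    using arg_cong[OF split, of size] by (simp add: len filter_eq_replicate_mset del: count_image_mset)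
  thus r: "r \<le> n" by simp
  have split': "image_mset ?f (mset gs) = image_mset \<sigma> (mset_set {1..r}) + replicate_mset (n - r) 0"
    by (subst split, subst filter_eq_replicate_mset, subst size) simp
  have "mset gs = image_mset (\<lambda>s. of_real (s\<^sup>2)) (image_mset ?f (mset gs))"
    unfolding image_mset.compositionality o_def
    by (subst image_mset_cong[where g = "\<lambda>z. z"]) (use nonneg in auto)
  also have "\<dots> = mset (padded_squares n r \<sigma>)"
    unfolding split' padded_squares_def
    by (simp add: image_mset.compositionality o_def mset_map[symmetric] del: mset_map)
       (simp add: mset_set_shift image_mset.compositionality o_def)
  finally have "mset gs = mset (padded_squares n r \<sigma>)" .
  thus "char_poly ?G = (\<Prod>e\<leftarrow>padded_squares n r \<sigma>. [:- e, 1:])"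
    unfolding gs by (rule linear_factors_cong)
qed

section \<open>Singular and polar decompositions\<close>

lemma unitary_expansion:
  assumes P: "unitary n P" and M: "M \<in> carrier_mat m n" and ab: "a < m" "b < n"
  shows "M $$ (a, b) = (\<Sum>c<n. (M * P) $$ (a, c) * cnj (P $$ (b, c)))"
proof -
  note Pc = unitaryD(1,2)[OF P]
  have "M = M * P * mat_adjoint P"
    by (simp add: assoc_mult_mat[OF M Pc] unitaryD(4)[OF P] right_mult_one_mat[OF M])
  hence "M $$ (a, b) = (M * P * mat_adjoint P) $$ (a, b)" by simp
  thus ?thesis
    by (simp only: mult_adjoint_index[OF mult_carrier_mat[OF M Pc(1)] Pc(1) ab])
qed

lemma singular_expansion_of_columns:
  assumes P: "unitary n P" and M: "M \<in> carrier_mat m n" and rn: "r \<le> n"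
    and cols: "\<And>a c. a < m \<Longrightarrow> c < n \<Longrightarrow>
      (M * P) $$ (a, c) = (if c < r then of_real (s (Suc c)) * u (Suc c) a else 0)"
    and ab: "a < m" "b < n"
  shows "M $$ (a, b) = singular_expansion r s u (\<lambda>i b. P $$ (b, i - 1)) a b"
proof -
  have "M $$ (a, b) = (\<Sum>c<n. if c < r then of_real (s (Suc c)) * u (Suc c) a * cnj (P $$ (b, c)) else 0)"
    unfolding unitary_expansion[OF P M ab] using ab by (intro sum.cong) (auto simp: cols)
  also have "\<dots> = (\<Sum>c<r. of_real (s (Suc c)) * u (Suc c) a * cnj (P $$ (b, c)))"
    using rn by (intro sum.mono_neutral_cong_right) auto
  also have "\<dots> = singular_expansion r s u (\<lambda>i b. P $$ (b, i - 1)) a b"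
    unfolding singular_expansion_def
    by (rule sum.reindex_bij_witness[where i = "\<lambda>i. i - 1" and j = Suc]) auto
  finally show ?thesis .
qed

lemma unitary_columns_orthonormal:
  assumes P: "unitary n P" and rn: "r \<le> n"
  shows "orthonormal_family n r (\<lambda>i b. P $$ (b, i - 1))"
  unfolding orthonormal_family_def overlap_def
proof (intro ballI)
  fix i j assume ij: "i \<in> {1..r}" "j \<in> {1..r}"
  hence ij': "j - 1 < n" "i - 1 < n" using rn by auto
  have "(\<Sum>a<n. P $$ (a, i - 1) * cnj (P $$ (a, j - 1))) = (mat_adjoint P * P) $$ (j - 1, i - 1)"
    by (subst adjoint_mult_index[OF unitaryD(1)[OF P] unitaryD(1)[OF P] ij']) (simp add: mult.commute)
  thus "(\<Sum>a<n. P $$ (a, i - 1) * cnj (P $$ (a, j - 1))) = of_bool (i = j)"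
    using ij ij' unitaryD(3)[OF P] by auto
qed

text \<open>
  Diagonalise \<open>A\<^sup>* A\<close> by a unitary \<open>P\<close>.  The columns of \<open>A P\<close> are then orthogonal with squared norms
  equal to the eigenvalues, so the first \<open>r\<close> of them can be normalised and the others vanish.
\<close>

lemma singular_value_decomposition:
  assumes A: "A \<in> carrier_mat m n" and sv: "has_nonzero_singular_values A r \<sigma>"
    and pos: "\<And>i. i \<in> {1..r} \<Longrightarrow> 0 < \<sigma> i"
  shows "\<exists>P u. unitary n P \<and> orthonormal_family m r u \<and>
    mat_adjoint P * (mat_adjoint A * A) * P
      = rect_diag n n (\<lambda>c. of_real ((if c < r then \<sigma> (Suc c) else 0)\<^sup>2)) \<and>
    (\<forall>a<m. \<forall>c<n. (A * P) $$ (a, c) = (if c < r then of_real (\<sigma> (Suc c)) * u (Suc c) a else 0))"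
proof -
  let ?G = "mat_adjoint A * A"
  have G: "?G \<in> carrier_mat n n" by (rule mult_carrier_mat[OF mat_adjoint_carrier[OF A] A])
  have rn: "r \<le> n" by (rule char_poly_gram(1)[OF A sv pos])
  from hermitian_spectral[OF G gram_hermitian[OF A] char_poly_gram(2)[OF A sv pos]] obtain P
    where P: "unitary n P" and D0: "mat_adjoint P * ?G * P = rect_diag n n ((!) (padded_squares n r \<sigma>))"
    by blast
  have D: "mat_adjoint P * ?G * P
      = rect_diag n n (\<lambda>c. of_real ((if c < r then \<sigma> (Suc c) else 0)\<^sup>2))"
    unfolding D0 by (rule eq_matI) (auto simp: padded_squares_nth[OF rn])
  note Pc = unitaryD(1,2)[OF P]
  have AP: "A * P \<in> carrier_mat m n" by (rule mult_carrier_mat[OF A Pc(1)])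
  have gram_eq: "mat_adjoint (A * P) * (A * P) = mat_adjoint P * ?G * P"
    using A Pc mat_adjoint_carrier[OF A]
    by (simp add: mat_adjoint_mult[OF A Pc(1)] assoc_mult_mat[OF Pc(2) mat_adjoint_carrier[OF A] AP]
        assoc_mult_mat[OF Pc(2) G Pc(1)] assoc_mult_mat[OF mat_adjoint_carrier[OF A] A Pc(1)])
  have gram: "(\<Sum>a<m. cnj ((A * P) $$ (a, c)) * (A * P) $$ (a, d))
      = (if c = d then of_real ((if c < r then \<sigma> (Suc c) else 0)\<^sup>2) else 0)"
    if "c < n" "d < n" for c d
    unfolding adjoint_mult_index[OF AP AP that, symmetric] gram_eq D using that by simp
  define u where "u i a = (A * P) $$ (a, i - 1) / of_real (\<sigma> i)" for i a
  have "orthonormal_family m r u"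
    unfolding orthonormal_family_def overlap_def
  proof (intro ballI)
    fix i j assume ij: "i \<in> {1..r}" "j \<in> {1..r}"
    hence ij': "j - 1 < n" "i - 1 < n" "i - 1 < r" "j - 1 < r" "Suc (j - 1) = j" using rn by auto
    have "(\<Sum>a<m. u i a * cnj (u j a))
        = (\<Sum>a<m. cnj ((A * P) $$ (a, j - 1)) * (A * P) $$ (a, i - 1)) / of_real (\<sigma> i * \<sigma> j)"
      by (simp add: u_def sum_divide_distrib mult.commute)
    also have "\<dots> = (if j - 1 = i - 1 then of_real ((\<sigma> j)\<^sup>2) else 0) / of_real (\<sigma> i * \<sigma> j)"
      using ij' by (simp only: gram if_True)
    also have "\<dots> = of_bool (i = j)"
      using ij pos[OF ij(1)] pos[OF ij(2)] by (auto simp: power2_eq_square)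
    finally show "(\<Sum>a<m. u i a * cnj (u j a)) = of_bool (i = j)" .
  qed
  moreover have "(A * P) $$ (a, c) = (if c < r then of_real (\<sigma> (Suc c)) * u (Suc c) a else 0)"
    if ac: "a < m" "c < n" for a c
  proof (cases "c < r")
    case True
    thus ?thesis using pos[of "Suc c"] by (simp add: u_def)
  next
    case False
    have "of_real (\<Sum>a<m. (cmod ((A * P) $$ (a, c)))\<^sup>2) = (0 :: complex)"
      unfolding of_real_sum complex_norm_square using gram[OF ac(2) ac(2)] False
      by (simp add: mult.commute)
    hence "(\<Sum>a<m. (cmod ((A * P) $$ (a, c)))\<^sup>2) = 0" by (simp only: of_real_eq_0_iff)
    hence "(cmod ((A * P) $$ (a, c)))\<^sup>2 = 0"
      using ac by (subst (asm) sum_nonneg_eq_0_iff) auto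
    thus ?thesis using False by simp
  qed
  ultimately show ?thesis using P D by blast
qed

lemma mem_column_space_iff:
  "M \<in> carrier_mat m n \<Longrightarrow> y \<in> column_space M \<longleftrightarrow> (\<exists>x \<in> carrier_vec n. y = M *\<^sub>v x)"
  unfolding column_space_def by (subst vec_space.col_space_eq) auto

text \<open>
  Since \<open>Q\<close> is isometric on the range of \<open>H\<close>, the vectors \<open>A x = Q (H x)\<close> and \<open>H x\<close> have equal
  norms.  Thus \<open>A\<^sup>* A\<close> and \<open>H\<^sup>2\<close> have the same quadratic form.
\<close>

lemma polar_positive_factor_squared:
  assumes gpd: "generalized_polar_decomposition m n r A Q H"
  shows "mat_adjoint A * A = H * H"
proof -
  have Q: "Q \<in> carrier_mat m n" and H: "H \<in> carrier_mat n n" and QH: "A = Q * H"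
    and herm: "mat_adjoint H = H" and sub: "subunitary Q"
    and ran: "column_space (mat_adjoint Q) = column_space H"
    using gpd by (auto simp: generalized_polar_decomposition_def rank_mat_def positive_semidefinite_def)
  have A: "A \<in> carrier_mat m n" unfolding QH by (rule mult_carrier_mat[OF Q H])
  have G: "mat_adjoint A * A \<in> carrier_mat n n" by (rule mult_carrier_mat[OF mat_adjoint_carrier[OF A] A])
  have HH: "H * H \<in> carrier_mat n n" by (rule mult_carrier_mat[OF H H])
  have HH': "H * H = mat_adjoint H * H" by (simp only: herm)
  have "mat_adjoint A * A - H * H = 0\<^sub>m n n"
  proof (rule hermitian_zero_form)
    show "mat_adjoint (mat_adjoint A * A - H * H) = mat_adjoint A * A - H * H"
    proof (rule eq_matI)
      fix i j assume "i < dim_row (mat_adjoint A * A - H * H)" "j < dim_col (mat_adjoint A * A - H * H)"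
      hence ij: "i < n" "j < n" using H by auto
      have "mat_adjoint (mat_adjoint A * A) $$ (i, j) = cnj ((mat_adjoint A * A) $$ (j, i))"
        "mat_adjoint (H * H) $$ (i, j) = cnj ((H * H) $$ (j, i))"
        using ij carrier_matD[OF G] carrier_matD[OF HH] by (simp_all del: index_mult_mat)
      hence "(mat_adjoint A * A) $$ (i, j) = cnj ((mat_adjoint A * A) $$ (j, i))"
        "(H * H) $$ (i, j) = cnj ((H * H) $$ (j, i))"
        using gram_hermitian[OF A] gram_hermitian[OF H] herm by simp_all
      thus "mat_adjoint (mat_adjoint A * A - H * H) $$ (i, j) = (mat_adjoint A * A - H * H) $$ (i, j)"
        using ij carrier_matD[OF G] carrier_matD[OF HH] by (simp del: index_mult_mat)
    qed (use H A in auto)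
    fix x :: "complex vec" assume x: "x \<in> carrier_vec n"
    have Hx: "H *\<^sub>v x \<in> carrier_vec n" using H x by simp
    have "H *\<^sub>v x \<in> column_space (mat_adjoint Q)"
      unfolding ran mem_column_space_iff[OF H] using x by blast
    hence "(A *\<^sub>v x) \<bullet>c (A *\<^sub>v x) = (H *\<^sub>v x) \<bullet>c (H *\<^sub>v x)"
      using sub unfolding subunitary_def QH by (simp add: assoc_mult_mat_vec[OF Q H x])
    hence "((mat_adjoint A * A) *\<^sub>v x) \<bullet>c x = ((H * H) *\<^sub>v x) \<bullet>c x"
      unfolding HH' gram_quadratic_form[OF A x] gram_quadratic_form[OF H x] .
    moreover have "((mat_adjoint A * A - H * H) *\<^sub>v x) \<bullet>c x
      = ((mat_adjoint A * A) *\<^sub>v x) \<bullet>c x - ((H * H) *\<^sub>v x) \<bullet>c x"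
      unfolding minus_mult_distrib_mat_vec[OF G HH x]
      by (rule minus_scalar_prod_distrib[of _ n]) (use mult_mat_vec_carrier[OF G x] mult_mat_vec_carrier[OF HH x] x in auto)
    ultimately show "((mat_adjoint A * A - H * H) *\<^sub>v x) \<bullet>c x = 0" by simp
  qed (rule minus_carrier_mat[OF HH])
  hence "(mat_adjoint A * A - H * H) $$ (i, j) = 0" if "i < n" "j < n" for i j
    using that by simp
  hence entry: "(mat_adjoint A * A) $$ (i, j) = (H * H) $$ (i, j)" if "i < n" "j < n" for i j
    using that carrier_matD[OF HH] index_minus_mat(1)[of i "H * H" j "mat_adjoint A * A"] by simp
  show ?thesis
    by (rule eq_matI) (use entry carrier_matD[OF G] carrier_matD[OF HH] in \<open>auto simp del: index_mult_mat\<close>)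
qed

text \<open>
  This is what uniqueness of the positive semidefinite square root amounts to on eigenvectors.
  The vector \<open>w = H p - s p\<close> satisfies \<open>H w = - s w\<close>, so positivity of \<open>H\<close> forces \<open>w = 0\<close> if \<open>s > 0\<close>;
  for \<open>s = 0\<close> the norm of \<open>H p\<close> is read off from \<open>H (H p) = 0\<close>.
\<close>

lemma psd_root_eigenvector:
  assumes H: "H \<in> carrier_mat n n" and psd: "positive_semidefinite H"
    and p: "p \<in> carrier_vec n" and s: "0 \<le> s"
    and HHp: "H *\<^sub>v (H *\<^sub>v p) = of_real (s\<^sup>2) \<cdot>\<^sub>v p"
  shows "H *\<^sub>v p = of_real s \<cdot>\<^sub>v p"
proof -
  have herm: "mat_adjoint H = H" using psd by (simp add: positive_semidefinite_def)
  have Hp: "H *\<^sub>v p \<in> carrier_vec n" using H p by simp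
  define w where "w = H *\<^sub>v p - of_real s \<cdot>\<^sub>v p"
  have w: "w \<in> carrier_vec n" using Hp p by (simp add: w_def)
  have "w = 0\<^sub>v n"
  proof (cases "s = 0")
    case True
    have "(H *\<^sub>v p) \<bullet>c (H *\<^sub>v p) = (H *\<^sub>v (H *\<^sub>v p)) \<bullet>c p"
      by (simp add: adjoint_cscalar_prod[OF H Hp p] herm)
    also have "\<dots> = 0" using p by (simp add: HHp True)
    finally have "H *\<^sub>v p = 0\<^sub>v n" using Hp by simp
    thus ?thesis using p by (simp add: w_def True) (intro eq_vecI, auto)
  next
    case False
    have "H *\<^sub>v w = H *\<^sub>v (H *\<^sub>v p) - of_real s \<cdot>\<^sub>v (H *\<^sub>v p)"
      unfolding w_def using p
      by (simp add: mult_minus_distrib_mat_vec[OF H Hp] mult_mat_vec[OF H p])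
    also have "\<dots> = (- of_real s) \<cdot>\<^sub>v w"
      unfolding HHp w_def using Hp p carrier_matD[OF H]
      by (intro eq_vecI) (auto simp: power2_eq_square algebra_simps)
    finally have "(H *\<^sub>v w) \<bullet>c w = (- of_real s) * (w \<bullet>c w)" using w by simp
    moreover have "0 \<le> (H *\<^sub>v w) \<bullet>c w" using psd w H by (auto simp: positive_semidefinite_def)
    moreover have "0 \<le> w \<bullet>c w" by (rule conjugate_square_ge_0_vec)
    ultimately have "Re (w \<bullet>c w) = 0" "Im (w \<bullet>c w) = 0"
      using s False by (auto simp: less_eq_complex_def mult_le_0_iff)
    hence "w \<bullet>c w = 0" by (simp add: complex_eq_iff)
    thus ?thesis using conjugate_square_eq_0_vec[OF w] by simp
  qed
  have "H *\<^sub>v p = w + of_real s \<cdot>\<^sub>v p" unfolding w_def using Hp p H by (intro eq_vecI) auto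
  thus ?thesis using p by (simp add: \<open>w = 0\<^sub>v n\<close>)
qed

text \<open>
  A column \<open>p\<close> of \<open>P\<close> is an eigenvector of \<open>H\<close> for \<open>s c\<close>, so \<open>A p = Q (H p)\<close> is a multiple of \<open>Q p\<close>.
  If \<open>s c = 0\<close>, then \<open>p\<close> is orthogonal to the range of \<open>H\<close>, which is the range of \<open>Q\<^sup>*\<close>, and
  therefore \<open>Q p = 0\<close>.
\<close>

lemma subunitary_factor_columns:
  assumes gpd: "generalized_polar_decomposition m n r A Q H" and P: "unitary n P"
    and D: "mat_adjoint P * (mat_adjoint A * A) * P = rect_diag n n (\<lambda>c. of_real ((s c)\<^sup>2))"
    and s: "\<And>c. c < n \<Longrightarrow> 0 \<le> s c" and ac: "a < m" "c < n"
  shows "(A * P) $$ (a, c) = of_real (s c) * (Q * P) $$ (a, c)"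
    and "s c = 0 \<Longrightarrow> (Q * P) $$ (a, c) = 0"
proof -
  have Q: "Q \<in> carrier_mat m n" and H: "H \<in> carrier_mat n n" and QH: "A = Q * H"
    and psd: "positive_semidefinite H" and herm: "mat_adjoint H = H"
    and ran: "column_space (mat_adjoint Q) = column_space H"
    using gpd by (auto simp: generalized_polar_decomposition_def rank_mat_def positive_semidefinite_def)
  have A: "A \<in> carrier_mat m n" unfolding QH by (rule mult_carrier_mat[OF Q H])
  note Pc = unitaryD(1,2)[OF P]
  have HH: "H * H \<in> carrier_mat n n" by (rule mult_carrier_mat[OF H H])
  define p where "p = col P c"
  have p: "p \<in> carrier_vec n" using Pc(1) by (auto simp: p_def)
  have HHP: "(H * H) * P = P * rect_diag n n (\<lambda>c. of_real ((s c)\<^sup>2))"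
    using unitary_conj_cancel[OF P HH] D unfolding polar_positive_factor_squared[OF gpd] by simp
  have "H *\<^sub>v (H *\<^sub>v p) = col ((H * H) * P) c"
    using ac by (simp add: p_def col_mult2[OF HH Pc(1)] assoc_mult_mat_vec[OF H H p[unfolded p_def]])
  also have "\<dots> = of_real ((s c)\<^sup>2) \<cdot>\<^sub>v p"
    unfolding HHP p_def
  proof (rule eq_vecI)
    fix i assume "i < dim_vec (of_real ((s c)\<^sup>2) \<cdot>\<^sub>v col P c)"
    hence i: "i < n" using Pc(1) by simp
    have "(P * rect_diag n n (\<lambda>c. of_real ((s c)\<^sup>2))) $$ (i, c)
        = (\<Sum>l<n. if l = c then P $$ (i, l) * of_real ((s c)\<^sup>2) else 0)"
      using i ac by (subst mat_mult_index[OF Pc(1) rect_diag_carrier])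
        (simp_all add: if_distrib cong: if_cong)
    thus "col (P * rect_diag n n (\<lambda>c. of_real ((s c)\<^sup>2))) c $ i = (of_real ((s c)\<^sup>2) \<cdot>\<^sub>v col P c) $ i"
      using i ac Pc(1) by (simp add: mult.commute del: index_mult_mat(1))
  qed (use Pc(1) in auto)
  finally have Hp: "H *\<^sub>v p = of_real (s c) \<cdot>\<^sub>v p"
    by (rule psd_root_eigenvector[OF H psd p s[OF ac(2)]])
  have Qp: "(Q * P) $$ (a, c) = (Q *\<^sub>v p) $ a"
    using ac Q Pc(1) by (simp add: p_def)
  have "(A * P) $$ (a, c) = (A *\<^sub>v p) $ a" using ac A Pc(1) by (simp add: p_def)
  also have "A *\<^sub>v p = of_real (s c) \<cdot>\<^sub>v (Q *\<^sub>v p)"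
    unfolding QH by (simp add: assoc_mult_mat_vec[OF Q H p] Hp mult_mat_vec[OF Q p])
  finally show "(A * P) $$ (a, c) = of_real (s c) * (Q * P) $$ (a, c)"
    using Q ac by (simp add: Qp del: index_mult_mat)
  assume "s c = 0"
  hence Hp0: "H *\<^sub>v p = 0\<^sub>v n" using Hp p by (intro eq_vecI) auto
  have Qpc: "Q *\<^sub>v p \<in> carrier_vec m" using Q p by simp
  have "mat_adjoint Q *\<^sub>v (Q *\<^sub>v p) \<in> column_space (mat_adjoint Q)"
    unfolding mem_column_space_iff[OF mat_adjoint_carrier[OF Q]] using Qpc by blast
  then obtain z where z: "z \<in> carrier_vec n" and Qz: "mat_adjoint Q *\<^sub>v (Q *\<^sub>v p) = H *\<^sub>v z"
    unfolding ran mem_column_space_iff[OF H] by blast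
  have "(Q *\<^sub>v p) \<bullet>c (Q *\<^sub>v p) = p \<bullet>c (mat_adjoint H *\<^sub>v z)"
    by (simp add: adjoint_cscalar_prod[OF Q p Qpc] Qz herm)
  also have "\<dots> = (H *\<^sub>v p) \<bullet>c z" by (simp only: adjoint_cscalar_prod[OF H p z])
  also have "\<dots> = 0" using z by (simp add: Hp0)
  finally have "Q *\<^sub>v p = 0\<^sub>v m" using conjugate_square_eq_0_vec[OF Qpc] by simp
  thus "(Q * P) $$ (a, c) = 0" using ac by (simp add: Qp del: index_mult_mat)
qed

text \<open>
  One unitary matrix diagonalises \<open>A\<^sup>* A\<close> and has eigenvectors of \<open>H\<close> as columns, so the same pair of
  orthonormal families expands both \<open>A\<close> and \<open>Q\<close>.
\<close>

lemma polar_singular_expansion: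
  assumes gpd: "generalized_polar_decomposition m n r A Q H"
    and sv: "has_nonzero_singular_values A r \<sigma>" and pos: "\<And>i. i \<in> {1..r} \<Longrightarrow> 0 < \<sigma> i"
  obtains u v where "orthonormal_family m r u" "orthonormal_family n r v"
    "\<And>a b. a < m \<Longrightarrow> b < n \<Longrightarrow> A $$ (a, b) = singular_expansion r \<sigma> u v a b"
    "\<And>a b. a < m \<Longrightarrow> b < n \<Longrightarrow> Q $$ (a, b) = singular_expansion r (\<lambda>_. 1) u v a b"
proof -
  have Q: "Q \<in> carrier_mat m n" and H: "H \<in> carrier_mat n n" and QH: "A = Q * H"
    using gpd by (auto simp: generalized_polar_decomposition_def rank_mat_def)
  have A: "A \<in> carrier_mat m n" unfolding QH by (rule mult_carrier_mat[OF Q H])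
  have rn: "r \<le> n" by (rule char_poly_gram(1)[OF A sv pos])
  obtain P u where P: "unitary n P" and u: "orthonormal_family m r u"
    and D: "mat_adjoint P * (mat_adjoint A * A) * P
      = rect_diag n n (\<lambda>c. of_real ((if c < r then \<sigma> (Suc c) else 0)\<^sup>2))"
    and AP: "\<And>a c. a < m \<Longrightarrow> c < n \<Longrightarrow>
      (A * P) $$ (a, c) = (if c < r then of_real (\<sigma> (Suc c)) * u (Suc c) a else 0)"
    using singular_value_decomposition[OF A sv pos] by blast
  have s: "0 \<le> (if c < r then \<sigma> (Suc c) else 0)" for c using pos[of "Suc c"] by auto
  have QP: "(Q * P) $$ (a, c) = (if c < r then of_real 1 * u (Suc c) a else 0)"
    if ac: "a < m" "c < n" for a c
    using subunitary_factor_columns[OF gpd P D s ac] AP[OF ac] pos[of "Suc c"] by (auto split: if_splits)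
  let ?v = "\<lambda>i b. P $$ (b, i - 1)"
  show ?thesis
  proof (rule that[OF u unitary_columns_orthonormal[OF P rn]])
    show "A $$ (a, b) = singular_expansion r \<sigma> u ?v a b" if "a < m" "b < n" for a b
      using singular_expansion_of_columns[OF P A rn AP that] by simp
    show "Q $$ (a, b) = singular_expansion r (\<lambda>_. 1) u ?v a b" if "a < m" "b < n" for a b
      using singular_expansion_of_columns[OF P Q rn QP that] by simp
  qed
qed

section \<open>Diagonal matrices with prescribed polar factors\<close>

text \<open>
  The optimal examples are rectangular diagonal matrices whose nonzero entries are the first
  \<open>r\<close> diagonal ones.
\<close>

definition padded_diag :: "nat \<Rightarrow> nat \<Rightarrow> nat \<Rightarrow> (nat \<Rightarrow> complex) \<Rightarrow> complex mat" where
  "padded_diag m n r d = rect_diag m n (\<lambda>i. if i < r then d i else 0)"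

lemma padded_diag_carrier [simp]: "padded_diag m n r d \<in> carrier_mat m n"
  and padded_diag_index [simp]:
    "i < m \<Longrightarrow> j < n \<Longrightarrow> padded_diag m n r d $$ (i, j) = (if i = j \<and> i < r then d i else 0)"
  and padded_diag_dim [simp]: "dim_row (padded_diag m n r d) = m" "dim_col (padded_diag m n r d) = n"
  by (auto simp: padded_diag_def)

lemma padded_diag_minus:
  "padded_diag m n r d - padded_diag m n r e = padded_diag m n r (\<lambda>i. d i - e i)"
  by (rule eq_matI) auto

lemma padded_diag_adjoint: "mat_adjoint (padded_diag m n r d) = padded_diag n m r (\<lambda>i. cnj (d i))"
  by (rule eq_matI) auto

lemma padded_diag_mult:
  assumes "r \<le> k"
  shows "padded_diag m k r d * padded_diag k n r e = padded_diag m n r (\<lambda>i. d i * e i)"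
proof (rule eq_matI)
  fix i j assume "i < dim_row (padded_diag m n r (\<lambda>i. d i * e i))"
    "j < dim_col (padded_diag m n r (\<lambda>i. d i * e i))"
  hence ij: "i < m" "j < n" by auto
  have "(padded_diag m k r d * padded_diag k n r e) $$ (i, j)
      = (\<Sum>l<k. padded_diag m k r d $$ (i, l) * padded_diag k n r e $$ (l, j))"
    by (rule mat_mult_index[OF padded_diag_carrier padded_diag_carrier ij])
  also have "\<dots> = (\<Sum>l<k. if l = i then (if i = j \<and> i < r then d i * e i else 0) else 0)"
    using ij by (intro sum.cong refl) auto
  finally show "(padded_diag m k r d * padded_diag k n r e) $$ (i, j) = padded_diag m n r (\<lambda>i. d i * e i) $$ (i, j)"
    using ij assms by (auto simp del: index_mult_mat)
qed auto

lemma padded_diag_mult_vec: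
  assumes "r \<le> n" "x \<in> carrier_vec n" "i < m"
  shows "(padded_diag m n r d *\<^sub>v x) $ i = (if i < r then d i * x $ i else 0)"
proof -
  have "(padded_diag m n r d *\<^sub>v x) $ i = (\<Sum>j<n. padded_diag m n r d $$ (i, j) * x $ j)"
    using assms by (auto simp: scalar_prod_def atLeast0LessThan)
  also have "\<dots> = (\<Sum>j<n. if j = i then (if i < r then d i * x $ i else 0) else 0)"
    using assms by (intro sum.cong refl) auto
  finally show ?thesis using assms by (simp del: index_mult_mat_vec)
qed

lemma frobenius_norm_padded_diag:
  assumes "r \<le> min m n"
  shows "frobenius_norm (padded_diag m n r d) = sqrt (\<Sum>i<r. (cmod (d i))\<^sup>2)"
proof -
  have "(\<Sum>i<m. \<Sum>j<n. (cmod (padded_diag m n r d $$ (i, j)))\<^sup>2)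
      = (\<Sum>i<m. \<Sum>j<n. if j = i then (if i < r then (cmod (d i))\<^sup>2 else 0) else 0)"
    by (intro sum.cong) auto
  also have "\<dots> = (\<Sum>i<m. if i < r then (cmod (d i))\<^sup>2 else 0)"
    using assms by (intro sum.cong) auto
  also have "\<dots> = (\<Sum>i<r. (cmod (d i))\<^sup>2)"
    using assms by (intro sum.mono_neutral_cong_right) auto
  finally show ?thesis by (simp add: frobenius_norm_def)
qed

lemma column_space_padded_diag:
  assumes rm: "r \<le> m" and rn: "r \<le> n" and d: "\<And>i. i < r \<Longrightarrow> d i \<noteq> 0"
  shows "column_space (padded_diag m n r d) = {y \<in> carrier_vec m. \<forall>i<m. r \<le> i \<longrightarrow> y $ i = 0}"
proof (intro equalityI subsetI)
  fix y assume "y \<in> column_space (padded_diag m n r d)"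
  then obtain x where x: "x \<in> carrier_vec n" and y: "y = padded_diag m n r d *\<^sub>v x"
    unfolding mem_column_space_iff[OF padded_diag_carrier] by blast
  show "y \<in> {y \<in> carrier_vec m. \<forall>i<m. r \<le> i \<longrightarrow> y $ i = 0}"
    using padded_diag_mult_vec[OF rn x] mult_mat_vec_carrier[OF padded_diag_carrier x]
    by (simp add: y del: index_mult_mat_vec)
next
  fix y :: "complex vec" assume y: "y \<in> {y \<in> carrier_vec m. \<forall>i<m. r \<le> i \<longrightarrow> y $ i = 0}"
  define x where "x = vec n (\<lambda>i. if i < r then y $ i / d i else 0)"
  have x: "x \<in> carrier_vec n" by (simp add: x_def)
  have "y = padded_diag m n r d *\<^sub>v x"
  proof (rule eq_vecI)
    fix i assume "i < dim_vec (padded_diag m n r d *\<^sub>v x)"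
    hence i: "i < m" by simp
    show "y $ i = (padded_diag m n r d *\<^sub>v x) $ i"
      unfolding padded_diag_mult_vec[OF rn x i] using i y rn d by (auto simp: x_def)
  qed (use y in auto)
  thus "y \<in> column_space (padded_diag m n r d)"
    unfolding mem_column_space_iff[OF padded_diag_carrier] using x by blast
qed

text \<open>
  The rank depends only on the column space, which does not change if the zero columns are dropped;
  the remaining \<open>r\<close> columns are linearly independent.
\<close>

lemma padded_diag_rank:
  assumes rm: "r \<le> m" and rn: "r \<le> n" and d: "\<And>i. i < r \<Longrightarrow> d i \<noteq> 0"
  shows "padded_diag m n r d \<in> rank_mat m n r"
proof -
  interpret vec_space "TYPE(complex)" m .
  \<comment> \<open>\<open>B\<close> consists of the first \<open>r\<close> columns of \<open>A\<close>.\<close>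
  define A B where "A = padded_diag m n r d" and "B = padded_diag m r r d"
  have B: "B \<in> carrier_mat m r" by (simp add: B_def)
  have "column_space A = column_space B"
    unfolding A_def B_def using column_space_padded_diag[OF rm rn, of d]
      column_space_padded_diag[OF rm order_refl, of d] d by simp
  hence "span (set (cols A)) = span (set (cols B))"
    unfolding column_space_def col_space_def by (simp add: A_def B_def col_space_def)
  hence "rank A = rank B" by (simp add: rank_def)
  also have dist: "distinct (cols B)"
    unfolding distinct_conv_nth
  proof (intro allI impI)
    fix i j assume "i < length (cols B)" "j < length (cols B)" "i \<noteq> j"
    hence ij: "i < r" "j < r" "i \<noteq> j" by (auto simp: B_def)
    have "col B i $ i \<noteq> col B j $ i" using ij rm d[of i] by (auto simp: B_def)
    thus "cols B ! i \<noteq> cols B ! j" using ij by (auto simp: B_def)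
  qed
  have "lin_indpt (set (cols B))"
  proof
    assume "lin_dep (set (cols B))"
    then obtain x where x: "x \<in> carrier_vec r" "x \<noteq> 0\<^sub>v r" "B *\<^sub>v x = 0\<^sub>v m"
      by (rule lin_depE[OF B _ dist])
    have "x $ i = 0" if i: "i < r" for i
    proof -
      have "d i * x $ i = (B *\<^sub>v x) $ i"
        using i rm by (simp add: B_def padded_diag_mult_vec[OF order_refl x(1)] del: index_mult_mat_vec)
      also have "\<dots> = 0" unfolding x(3) using i rm by simp
      finally show ?thesis using d[OF i] by simp
    qed
    thus False using x by (auto intro!: eq_vecI)
  qed
  hence "rank B = r" by (rule lin_indpt_full_rank[OF B dist])
  finally show ?thesis by (simp add: rank_mat_def A_def)
qed

text \<open>
  The phases of the diagonal entries form the subunitary factor, and their moduli form the positive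
  factor.
\<close>

lemma padded_diag_polar_decomposition:
  assumes rm: "r \<le> m" and rn: "r \<le> n" and d: "\<And>i. i < r \<Longrightarrow> cmod (d i) = 1"
    and s: "\<And>i. i < r \<Longrightarrow> 0 < s i"
  shows "generalized_polar_decomposition m n r
    (padded_diag m n r (\<lambda>i. d i * of_real (s i))) (padded_diag m n r d) (padded_diag n n r (\<lambda>i. of_real (s i)))"
proof -
  let ?Q = "padded_diag m n r d" and ?H = "padded_diag n n r (\<lambda>i. complex_of_real (s i))"
  have d0: "d i \<noteq> 0" if "i < r" for i using d[OF that] by auto
  have s0: "complex_of_real (s i) \<noteq> 0" if "i < r" for i using s[OF that] by auto
  have ran: "column_space (mat_adjoint ?Q) = {y \<in> carrier_vec n. \<forall>i<n. r \<le> i \<longrightarrow> y $ i = 0}"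
    unfolding padded_diag_adjoint using d0 by (intro column_space_padded_diag rm rn) auto
  moreover have "column_space ?H = {y \<in> carrier_vec n. \<forall>i<n. r \<le> i \<longrightarrow> y $ i = 0}"
    using s0 by (intro column_space_padded_diag rn) auto
  moreover have "?Q \<in> rank_mat m n r" using d0 by (intro padded_diag_rank rm rn)
  moreover have "?H \<in> rank_mat n n r" using s0 by (intro padded_diag_rank rn)
  moreover have "subunitary ?Q"
    unfolding subunitary_def ran
  proof
    fix x :: "complex vec" assume x: "x \<in> {y \<in> carrier_vec n. \<forall>i<n. r \<le> i \<longrightarrow> y $ i = 0}"
    hence xc: "x \<in> carrier_vec n" by simp
    have Qx: "?Q *\<^sub>v x \<in> carrier_vec m" by (rule mult_mat_vec_carrier[OF padded_diag_carrier xc])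
    have "(?Q *\<^sub>v x) \<bullet>c (?Q *\<^sub>v x) = (\<Sum>i<m. if i < r then x $ i * cnj (x $ i) else 0)"
      unfolding cscalar_prod_sum[OF Qx Qx]
    proof (rule sum.cong)
      fix i assume "i \<in> {..<m}"
      hence i: "i < m" by simp
      have "d i * x $ i * cnj (d i * x $ i) = x $ i * cnj (x $ i)" if "i < r"
      proof -
        have "d i * x $ i * cnj (d i * x $ i) = (d i * cnj (d i)) * (x $ i * cnj (x $ i))" by simp
        thus ?thesis using d[OF that] by (simp add: complex_norm_square[symmetric])
      qed
      thus "(?Q *\<^sub>v x) $ i * cnj ((?Q *\<^sub>v x) $ i) = (if i < r then x $ i * cnj (x $ i) else 0)"
        unfolding padded_diag_mult_vec[OF rn xc i] by simp
    qed simp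
    also have "\<dots> = (\<Sum>i<r. x $ i * cnj (x $ i))"
      using rm by (intro sum.mono_neutral_cong_right) auto
    also have "\<dots> = (\<Sum>i<n. x $ i * cnj (x $ i))"
      using rn x by (intro sum.mono_neutral_cong_left) auto
    finally show "(?Q *\<^sub>v x) \<bullet>c (?Q *\<^sub>v x) = x \<bullet>c x"
      unfolding cscalar_prod_sum[OF xc xc] .
  qed
  moreover have "positive_semidefinite ?H"
    unfolding positive_semidefinite_def
  proof (intro conjI ballI)
    fix x :: "complex vec" assume "x \<in> carrier_vec (dim_col ?H)"
    hence x: "x \<in> carrier_vec n" by simp
    have Hx: "?H *\<^sub>v x \<in> carrier_vec n" by (rule mult_mat_vec_carrier[OF padded_diag_carrier x])
    have "(?H *\<^sub>v x) \<bullet>c x = (\<Sum>i<n. of_real (if i < r then s i * (cmod (x $ i))\<^sup>2 else 0))"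
      unfolding cscalar_prod_sum[OF Hx x]
    proof (rule sum.cong)
      fix i assume "i \<in> {..<n}"
      hence i: "i < n" by simp
      have "of_real (s i) * x $ i * cnj (x $ i) = of_real (s i * (cmod (x $ i))\<^sup>2)"
        by (simp only: of_real_mult complex_norm_square mult.assoc)
      thus "(?H *\<^sub>v x) $ i * cnj (x $ i) = of_real (if i < r then s i * (cmod (x $ i))\<^sup>2 else 0)"
        unfolding padded_diag_mult_vec[OF rn x i] by simp
    qed simp
    also have "\<dots> = of_real (\<Sum>i<n. if i < r then s i * (cmod (x $ i))\<^sup>2 else 0)" by simp
    finally have "(?H *\<^sub>v x) \<bullet>c x = of_real (\<Sum>i<n. if i < r then s i * (cmod (x $ i))\<^sup>2 else 0)" .
    moreover have "0 \<le> (\<Sum>i<n. if i < r then s i * (cmod (x $ i))\<^sup>2 else 0)"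
      by (intro sum_nonneg) (use s in \<open>auto simp: less_imp_le\<close>)
    ultimately show "0 \<le> (?H *\<^sub>v x) \<bullet>c x" by (simp add: less_eq_complex_def)
  qed (auto simp: padded_diag_adjoint)
  ultimately show ?thesis
    unfolding generalized_polar_decomposition_def by (simp add: padded_diag_mult[OF rn])
qed

lemma padded_diag_singular_values:
  assumes rm: "r \<le> m" and rn: "r \<le> n" and d: "\<And>i. i < r \<Longrightarrow> d i \<noteq> 0"
    and \<sigma>: "image_mset (\<lambda>i. cmod (d i)) (mset_set {0..<r}) = image_mset \<sigma> (mset_set {1..r})"
  shows "has_nonzero_singular_values (padded_diag m n r d) r \<sigma>"
proof -
  let ?D = "padded_diag n n r (\<lambda>i. cnj (d i) * d i)"
  have gram: "mat_adjoint (padded_diag m n r d) * padded_diag m n r d = ?D"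
    by (simp add: padded_diag_adjoint padded_diag_mult[OF rm])
  have "upper_triangular ?D" by (auto simp: upper_triangular_def)
  hence "char_poly ?D = (\<Prod>a\<leftarrow>diag_mat ?D. [:- a, 1:])"
    by (rule char_poly_upper_triangular[OF padded_diag_carrier])
  hence "proots (char_poly ?D) = mset (diag_mat ?D)" by (simp add: proots_linear_factors)
  also have "diag_mat ?D = map (\<lambda>i. if i < r then cnj (d i) * d i else 0) [0..<n]"
    by (auto simp: diag_mat_def)
  finally have "singular_values (padded_diag m n r d)
      = image_mset (\<lambda>i. if i < r then cmod (d i) else 0) (mset_set {0..<n})"
    unfolding singular_values_def gram
    by (simp add: image_mset.compositionality o_def)
       (intro image_mset_cong, simp add: cmod_def power2_eq_square)
  hence "{#s \<in># singular_values (padded_diag m n r d). s \<noteq> 0#}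
      = image_mset (\<lambda>i. if i < r then cmod (d i) else 0)
          {#i \<in># mset_set {0..<n}. (if i < r then cmod (d i) else 0) \<noteq> 0#}"
    by (simp add: filter_mset_image_mset)
  also have "{#i \<in># mset_set {0..<n}. (if i < r then cmod (d i) else 0) \<noteq> 0#} = mset_set {0..<r}"
    using rn d by (subst filter_mset_mset_set) (auto intro!: arg_cong[where f = mset_set])
  also have "image_mset (\<lambda>i. if i < r then cmod (d i) else 0) (mset_set {0..<r})
      = image_mset (\<lambda>i. cmod (d i)) (mset_set {0..<r})"
    by (intro image_mset_cong) auto
  finally show ?thesis by (simp add: has_nonzero_singular_values_def \<sigma>)
qed

section \<open>The perturbation bound and its sharpness\<close>

lemma polar_coefficient_flip_distance:
  "polar_coefficient r \<sigma> \<sigma>' = sqrt (MAX k \<in> {1..r}. 4 * real k / flip_distance r \<sigma> \<sigma>' k)"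
  unfolding polar_coefficient_def
  by (intro arg_cong[where f = sqrt] arg_cong[where f = Max] image_cong refl)
     (simp add: flip_distance_eq)

text \<open>
  For \<open>k \<ge> 1\<close> the smallest value \<open>\<sigma> r\<close> is paired with sign \<open>-1\<close>, which contributes the square of a sum of
  positive numbers.
\<close>

lemma flip_distance_pos:
  assumes dec: "decreasing_positive r \<sigma>" "decreasing_positive r \<sigma>'" and k: "k \<in> {1..r}"
  shows "0 < flip_distance r \<sigma> \<sigma>' k"
proof -
  have r: "r \<in> {1..r}" and "tail_sign r k r = -1" using k by (auto simp: tail_sign_def)
  moreover have "flip_tail r k r \<in> {1..r}"
    using bij_betwE[OF bij_flip_tail[of k r]] k r by auto
  ultimately have "0 < (\<sigma> r - tail_sign r k r * \<sigma>' (flip_tail r k r))\<^sup>2"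
    using decreasing_positiveD(2)[OF dec(1), of r] decreasing_positiveD(2)[OF dec(2), of "flip_tail r k r"]
    by (simp add: zero_less_power2)
  thus ?thesis unfolding flip_distance_def using r
    by (intro sum_pos2[of _ r]) auto
qed

lemma polar_perturbation_bound:
  assumes dec: "decreasing_positive r \<sigma>" "decreasing_positive r \<sigma>'"
    and gpd: "generalized_polar_decomposition m n r A Q H"
      "generalized_polar_decomposition m n r A' Q' H'"
    and sv: "has_nonzero_singular_values A r \<sigma>" "has_nonzero_singular_values A' r \<sigma>'"
    and K: "0 \<le> K" "\<And>k. k \<in> {1..r} \<Longrightarrow> 4 * real k \<le> K * flip_distance r \<sigma> \<sigma>' k"
  shows "frobenius_norm (Q - Q') \<le> sqrt K * frobenius_norm (A' - A)"
proof -
  have QH: "Q \<in> carrier_mat m n" "H \<in> carrier_mat n n" "A = Q * H"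
    and QH': "Q' \<in> carrier_mat m n" "H' \<in> carrier_mat n n" "A' = Q' * H'"
    using gpd by (auto simp: generalized_polar_decomposition_def rank_mat_def)
  have A: "A \<in> carrier_mat m n" and A': "A' \<in> carrier_mat m n"
    unfolding QH(3) QH'(3) by (rule mult_carrier_mat[OF QH(1,2)] mult_carrier_mat[OF QH'(1,2)])+
  obtain u v where uv: "orthonormal_family m r u" "orthonormal_family n r v"
    and Ae: "\<And>a b. a < m \<Longrightarrow> b < n \<Longrightarrow> A $$ (a, b) = singular_expansion r \<sigma> u v a b"
    and Qe: "\<And>a b. a < m \<Longrightarrow> b < n \<Longrightarrow> Q $$ (a, b) = singular_expansion r (\<lambda>_. 1) u v a b"
    by (rule polar_singular_expansion[OF gpd(1) sv(1)]) (use decreasing_positiveD(2)[OF dec(1)] in auto)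
  obtain w x where wx: "orthonormal_family m r w" "orthonormal_family n r x"
    and Ae': "\<And>a b. a < m \<Longrightarrow> b < n \<Longrightarrow> A' $$ (a, b) = singular_expansion r \<sigma>' w x a b"
    and Qe': "\<And>a b. a < m \<Longrightarrow> b < n \<Longrightarrow> Q' $$ (a, b) = singular_expansion r (\<lambda>_. 1) w x a b"
    by (rule polar_singular_expansion[OF gpd(2) sv(2)]) (use decreasing_positiveD(2)[OF dec(2)] in auto)
  have K': "4 * real k \<le> K * flip_distance r \<sigma> \<sigma>' k" if "k \<le> r" for k
    using K that by (cases "k = 0") (auto simp: flip_distance_def intro!: mult_nonneg_nonneg sum_nonneg)
  let ?q = "\<Sum>a<m. \<Sum>b<n.
      (cmod (singular_expansion r (\<lambda>_. 1) u v a b - singular_expansion r (\<lambda>_. 1) w x a b))\<^sup>2"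
  let ?e = "\<Sum>a<m. \<Sum>b<n.
      (cmod (singular_expansion r \<sigma> u v a b - singular_expansion r \<sigma>' w x a b))\<^sup>2"
  have "frobenius_norm (Q - Q') = sqrt ?q"
    using QH(1) QH'(1) by (auto simp: frobenius_norm_def Qe Qe')
  also have "\<dots> \<le> sqrt (K * ?e)"
    by (rule real_sqrt_le_mono[OF polar_perturbation_expansion[OF uv(1) wx(1) uv(2) wx(2) dec K(1) K']])
  also have "\<dots> = sqrt K * sqrt ?e" by (rule real_sqrt_mult)
  also have "sqrt ?e = frobenius_norm (A' - A)"
    using A A' by (auto simp: frobenius_norm_def Ae Ae' norm_minus_commute)
  finally show ?thesis .
qed

text \<open>
  All singular vectors are standard basis vectors, in the order prescribed by the extremal
  pairing, and the signs are put into the subunitary factor of the second matrix.  Each of the \<open>k\<close>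
  negative signs contributes \<open>\<bar>1 - (-1)\<bar>\<^sup>2 = 4\<close> to the distance of the subunitary factors.
\<close>

lemma polar_perturbation_bound_sharp:
  assumes dec: "decreasing_positive r \<sigma>" "decreasing_positive r \<sigma>'"
    and rmn: "r \<le> min m n" and k: "k \<in> {1..r}"
  shows "\<exists>A A' Q H Q' H'. A \<in> rank_mat m n r \<and> A' \<in> rank_mat m n r \<and>
    generalized_polar_decomposition m n r A Q H \<and> generalized_polar_decomposition m n r A' Q' H' \<and>
    has_nonzero_singular_values A r \<sigma> \<and> has_nonzero_singular_values A' r \<sigma>' \<and>
    frobenius_norm (Q - Q') = sqrt (4 * real k) \<and>
    frobenius_norm (A' - A) = sqrt (flip_distance r \<sigma> \<sigma>' k)"
proof -
  define s t where "s i = \<sigma> (Suc i)" and "t i = \<sigma>' (flip_tail r k (Suc i))" for i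
  define \<epsilon> where "\<epsilon> i = complex_of_real (tail_sign r k (Suc i))" for i
  have rm: "r \<le> m" and rn: "r \<le> n" using rmn by auto
  have shift: "bij_betw Suc {0..<r} {1..r}"
    by (rule bij_betwI[where g = "\<lambda>i. i - 1"]) auto
  have flip: "bij_betw (flip_tail r k) {1..r} {1..r}" using k by (intro bij_flip_tail) auto
  have s: "0 < s i" if "i < r" for i
    using decreasing_positiveD(2)[OF dec(1), of "Suc i"] that by (simp add: s_def)
  have t: "0 < t i" if "i < r" for i
  proof -
    have "flip_tail r k (Suc i) \<in> {1..r}" using bij_betwE[OF flip] that by auto
    thus ?thesis using decreasing_positiveD(2)[OF dec(2)] by (auto simp: t_def)
  qed
  have s0: "s i \<noteq> 0" and t0: "t i \<noteq> 0" if "i < r" for i using s[OF that] t[OF that] by auto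
  have \<epsilon>: "cmod (\<epsilon> i) = 1" for i by (simp add: \<epsilon>_def tail_sign_def)
  define A where "A = padded_diag m n r (\<lambda>i. 1 * complex_of_real (s i))"
  define A' where "A' = padded_diag m n r (\<lambda>i. \<epsilon> i * complex_of_real (t i))"
  have A: "A \<in> rank_mat m n r" unfolding A_def using s0 by (intro padded_diag_rank rm rn) auto
  have A': "A' \<in> rank_mat m n r"
    unfolding A'_def using t0 by (intro padded_diag_rank rm rn) (auto simp: \<epsilon>_def tail_sign_def)
  have gpd: "generalized_polar_decomposition m n r A
      (padded_diag m n r (\<lambda>_. 1)) (padded_diag n n r (\<lambda>i. of_real (s i)))"
    unfolding A_def by (rule padded_diag_polar_decomposition[OF rm rn _ s]) auto
  have gpd': "generalized_polar_decomposition m n r A'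
      (padded_diag m n r \<epsilon>) (padded_diag n n r (\<lambda>i. of_real (t i)))"
    unfolding A'_def by (rule padded_diag_polar_decomposition[OF rm rn \<epsilon> t])
  have reindex: "image_mset (\<lambda>i. f (Suc i)) (mset_set {0..<r}) = image_mset f (mset_set {1..r})"
    for f :: "nat \<Rightarrow> real"
    using bij_betw_imp_inj_on[OF shift] bij_betw_imp_surj_on[OF shift]
    by (metis (no_types, lifting) image_mset_mset_set multiset.map_comp o_def multiset.map_cong0)
  have sv: "has_nonzero_singular_values A r \<sigma>"
    unfolding A_def
  proof (rule padded_diag_singular_values[OF rm rn])
    have "image_mset (\<lambda>i. cmod (1 * complex_of_real (s i))) (mset_set {0..<r})
        = image_mset (\<lambda>i. \<sigma> (Suc i)) (mset_set {0..<r})"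
      using s by (intro image_mset_cong) (auto simp: s_def less_imp_le)
    thus "image_mset (\<lambda>i. cmod (1 * complex_of_real (s i))) (mset_set {0..<r}) = image_mset \<sigma> (mset_set {1..r})"
      by (simp only: reindex)
  qed (use s0 in auto)
  have sv': "has_nonzero_singular_values A' r \<sigma>'"
    unfolding A'_def
  proof (rule padded_diag_singular_values[OF rm rn])
    have "image_mset (\<lambda>i. cmod (\<epsilon> i * complex_of_real (t i))) (mset_set {0..<r})
        = image_mset (\<lambda>i. \<sigma>' (flip_tail r k (Suc i))) (mset_set {0..<r})"
      using t by (intro image_mset_cong) (auto simp: t_def norm_mult \<epsilon> less_imp_le)
    also have "\<dots> = image_mset (\<lambda>i. \<sigma>' (flip_tail r k i)) (mset_set {1..r})" by (rule reindex)
    also have "\<dots> = image_mset \<sigma>' (image_mset (flip_tail r k) (mset_set {1..r}))"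
      by (simp add: multiset.map_comp o_def)
    also have "\<dots> = image_mset \<sigma>' (mset_set {1..r})"
      using bij_betw_imp_inj_on[OF flip] bij_betw_imp_surj_on[OF flip] by (simp only: image_mset_mset_set)
    finally show "image_mset (\<lambda>i. cmod (\<epsilon> i * complex_of_real (t i))) (mset_set {0..<r})
      = image_mset \<sigma>' (mset_set {1..r})" .
  qed (use t0 in \<open>auto simp: \<epsilon>_def tail_sign_def\<close>)
  have sum_shift: "(\<Sum>i<r. f (Suc i)) = (\<Sum>i = 1..r. f i)" for f :: "nat \<Rightarrow> real"
    using sum.reindex_bij_betw[OF shift, of f] by (simp add: atLeast0LessThan)
  have "(\<Sum>i<r. (cmod (1 - \<epsilon> i))\<^sup>2) = (\<Sum>i = 1..r. if i \<le> r - k then 0 else 4)"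
    unfolding sum_shift[symmetric] by (intro sum.cong) (auto simp: \<epsilon>_def tail_sign_def)
  also have "\<dots> = (\<Sum>i = r - k + 1..r. 4)" by (rule sum.mono_neutral_cong_right) auto
  also have "\<dots> = 4 * real k" using k by simp
  finally have Qd: "frobenius_norm (padded_diag m n r (\<lambda>_. 1) - padded_diag m n r \<epsilon>) = sqrt (4 * real k)"
    by (simp add: padded_diag_minus frobenius_norm_padded_diag[OF rmn])
  have "(\<Sum>i<r. (cmod (\<epsilon> i * complex_of_real (t i) - 1 * complex_of_real (s i)))\<^sup>2)
      = (\<Sum>i<r. (\<sigma> (Suc i) - tail_sign r k (Suc i) * \<sigma>' (flip_tail r k (Suc i)))\<^sup>2)"
  proof (rule sum.cong)
    fix i
    have "\<epsilon> i * complex_of_real (t i) - 1 * complex_of_real (s i)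
        = of_real (tail_sign r k (Suc i) * \<sigma>' (flip_tail r k (Suc i)) - \<sigma> (Suc i))"
      by (simp add: \<epsilon>_def t_def s_def)
    thus "(cmod (\<epsilon> i * complex_of_real (t i) - 1 * complex_of_real (s i)))\<^sup>2
      = (\<sigma> (Suc i) - tail_sign r k (Suc i) * \<sigma>' (flip_tail r k (Suc i)))\<^sup>2"
      by (simp only: norm_of_real power2_abs power2_commute)
  qed simp
  also have "\<dots> = flip_distance r \<sigma> \<sigma>' k"
    unfolding flip_distance_def by (rule sum_shift)
  finally have Ad: "frobenius_norm (A' - A) = sqrt (flip_distance r \<sigma> \<sigma>' k)"
    unfolding A_def A'_def by (simp only: padded_diag_minus frobenius_norm_padded_diag[OF rmn])
  show ?thesis using A A' gpd gpd' sv sv' Qd Ad by blast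
qed

theorem corollary1p6:
  fixes m n r :: nat and \<sigma> \<sigma>' :: "nat \<Rightarrow> real"
  assumes "r \<ge> 1"
    and "decreasing_positive r \<sigma>"
    and "decreasing_positive r \<sigma>'"
  shows "(\<forall>A E Q H Q' H'.
           A \<in> rank_mat m n r \<longrightarrow>
           E \<in> carrier_mat m n \<longrightarrow>
           A + E \<in> rank_mat m n r \<longrightarrow>
           generalized_polar_decomposition m n r A Q H \<longrightarrow>
           generalized_polar_decomposition m n r (A + E) Q' H' \<longrightarrow>
           has_nonzero_singular_values A r \<sigma> \<longrightarrow>
           has_nonzero_singular_values (A + E) r \<sigma>' \<longrightarrow>
           frobenius_norm (Q - Q') \<le> polar_coefficient r \<sigma> \<sigma>' * frobenius_norm E)
       \<and> (r \<le> min m n \<longrightarrow>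
         (\<forall>c < polar_coefficient r \<sigma> \<sigma>'.
           \<not> (\<forall>A E Q H Q' H'.
                A \<in> rank_mat m n r \<longrightarrow>
                E \<in> carrier_mat m n \<longrightarrow>
                A + E \<in> rank_mat m n r \<longrightarrow>
                generalized_polar_decomposition m n r A Q H \<longrightarrow>
                generalized_polar_decomposition m n r (A + E) Q' H' \<longrightarrow>
                has_nonzero_singular_values A r \<sigma> \<longrightarrow>
                has_nonzero_singular_values (A + E) r \<sigma>' \<longrightarrow>
                frobenius_norm (Q - Q') \<le> c * frobenius_norm E)))"
proof (intro conjI allI impI notI)
  let ?D = "flip_distance r \<sigma> \<sigma>'"
  define K where "K = (MAX k \<in> {1..r}. 4 * real k / ?D k)"
  have coeff: "polar_coefficient r \<sigma> \<sigma>' = sqrt K"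
    by (simp add: polar_coefficient_flip_distance K_def)
  have D: "0 < ?D k" if "k \<in> {1..r}" for k by (rule flip_distance_pos[OF assms(2,3) that])
  have K_ge: "4 * real k / ?D k \<le> K" if "k \<in> {1..r}" for k
    unfolding K_def using that by (intro Max_ge) auto
  {
    fix A E Q H Q' H'
    assume A: "A \<in> rank_mat m n r" and E: "E \<in> carrier_mat m n"
      and gpd: "generalized_polar_decomposition m n r A Q H"
        "generalized_polar_decomposition m n r (A + E) Q' H'"
      and sv: "has_nonzero_singular_values A r \<sigma>" "has_nonzero_singular_values (A + E) r \<sigma>'"
    have "0 \<le> 4 * real r / ?D r" using D[of r] assms(1) by simp
    also have "\<dots> \<le> K" using K_ge[of r] assms(1) by simp
    finally have K0: "0 \<le> K" .
    have "4 * real k \<le> K * ?D k" if "k \<in> {1..r}" for k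
      using K_ge[OF that] D[OF that] by (simp add: pos_divide_le_eq)
    hence "frobenius_norm (Q - Q') \<le> sqrt K * frobenius_norm (A + E - A)"
      by (rule polar_perturbation_bound[OF assms(2,3) gpd sv K0])
    also have "A + E - A = E" using A E by (intro eq_matI) (auto simp: rank_mat_def)
    finally show "frobenius_norm (Q - Q') \<le> polar_coefficient r \<sigma> \<sigma>' * frobenius_norm E"
      by (simp only: coeff)
  next
    fix c
    assume rmn: "r \<le> min m n" and c: "c < polar_coefficient r \<sigma> \<sigma>'"
      and bound: "\<forall>A E Q H Q' H'.
                A \<in> rank_mat m n r \<longrightarrow>
                E \<in> carrier_mat m n \<longrightarrow>
                A + E \<in> rank_mat m n r \<longrightarrow>
                generalized_polar_decomposition m n r A Q H \<longrightarrow>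
                generalized_polar_decomposition m n r (A + E) Q' H' \<longrightarrow>
                has_nonzero_singular_values A r \<sigma> \<longrightarrow>
                has_nonzero_singular_values (A + E) r \<sigma>' \<longrightarrow>
                frobenius_norm (Q - Q') \<le> c * frobenius_norm E"
    have "K \<in> (\<lambda>k. 4 * real k / ?D k) ` {1..r}"
      unfolding K_def using assms(1) by (intro Max_in) auto
    then obtain k where k: "k \<in> {1..r}" and Kk: "K = 4 * real k / ?D k" by blast
    obtain A A' Q H Q' H' where ex: "A \<in> rank_mat m n r" "A' \<in> rank_mat m n r"
      "generalized_polar_decomposition m n r A Q H" "generalized_polar_decomposition m n r A' Q' H'"
      "has_nonzero_singular_values A r \<sigma>" "has_nonzero_singular_values A' r \<sigma>'"
      "frobenius_norm (Q - Q') = sqrt (4 * real k)" "frobenius_norm (A' - A) = sqrt (?D k)"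
      using polar_perturbation_bound_sharp[OF assms(2,3) rmn k] by blast
    have E: "A' - A \<in> carrier_mat m n" and AE: "A + (A' - A) = A'"
      using ex(1,2) by (auto simp: rank_mat_def intro!: eq_matI)
    have "sqrt (4 * real k) \<le> c * sqrt (?D k)"
      using bound[rule_format, of A "A' - A" Q H Q' H'] E ex by (simp add: AE)
    also have "\<dots> < sqrt K * sqrt (?D k)"
      using c D[OF k] by (intro mult_strict_right_mono) (auto simp: coeff)
    also have "\<dots> = sqrt (4 * real k)"
      using D[OF k] by (simp add: real_sqrt_mult[symmetric] Kk)
    finally show False by simp
  }
qed

end
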